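(* Let $d\geq 4$, $k\in\{2,3,\ldots,d-2\}$, and $m:=\min\{d-k,k\}$. Then there exists a constant $C(k,d)<\infty$ such that the estimate $$\|\widehat{f}\|_{L^{\frac{2m}{m-1},\infty}(\mathbb{S}^{d-1})}\leq C(k,d)\,\|f\|_{X_{\frac{2m}{m+1}}}$$ holds for every $G_k$-symmetric function $f:\mathbb{R}^d\to\mathbb{C}$.
   Context: $\mathbb{S}^{d-1}\subset\mathbb{R}^d$ is the unit sphere with its usual surface measure $\sigma$. The Fourier transform is $\widehat f(\xi)=\int_{\mathbb{R}^d} f(x)e^{-i\xi\cdot x}\,dx$. Write $\mathbb{R}^d=\mathbb{R}^{d-k}\times\mathbb{R}^k$ and let $G_k:=O(d-k)\times O(k)\subset O(d)$ act blockwise. A function $f:\mathbb{R}^d\to\mathbb{C}$ is $G_k$-symmetric if $f\circ A=f$ for every $A\in G_k$. $L^{p,s}$ denotes the usual Lorentz spaces. The space $X_p$ is defined as follows: if $m<\frac d2$, then $X_p:=L^{p,1}(\mathbb{R}^d)$; if $m=\frac d2$, then $$X_p:=L_x^{p,1}(\mathbb{R}^{d-k};L_y^{p,1}(\mathbb{R}^k))+L_y^{p,1}(\mathbb{R}^k;L_x^{p,1}(\mathbb{R}^{d-k})),$$ where $(x,y)\in\mathbb{R}^{d-k}\times\mathbb{R}^k$, the mixed Lorentz space $L_x^{p,1}(\mathbb{R}^{d-k};L_y^{p,1}(\mathbb{R}^k))$ has (quasi-)norm obtained by taking the $L^{p,1}(\mathbb{R}^{d-k})$ (quasi-)norm in $x$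 of $x\mapsto \|f(x,\cdot)\|_{L^{p,1}(\mathbb{R}^k)}$ (analogously with the roles of $x,y$ exchanged), and the sum of two spaces carries the usual (quasi-)norm $\inf\{\|f_1\|+\|f_2\|: f=f_1+f_2\}$. As usual in restriction theory, the estimate is understood a priori for $G_k$-symmetric Schwartz functions. *)

theory Defs
  imports "HOL-Analysis.Analysis"
begin

section \<open>Lorentz quasi-norms\<close>

(* Powers with a positive exponent, extended by \<infinity>^a = \<infinity>. *)
definition epowr :: "ennreal \<Rightarrow> real \<Rightarrow> ennreal" where
  "epowr x a = (if x = \<infinity> then \<infinity> else ennreal (enn2real x powr a))"

definition distribution_function :: "'a measure \<Rightarrow> ('a \<Rightarrow> ennreal) \<Rightarrow> real \<Rightarrow> ennreal" where
  "distribution_function M g t = emeasure M {x \<in> space M. ennreal t < g x}"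

(* The L^{p,s} quasi-norm
     p^{1/s} ( \<integral>_0^\<infinity> (t \<mu>{g > t}^{1/p})^s dt/t )^{1/s}   (s < \<infinity>),
     sup_{t > 0} t \<mu>{g > t}^{1/p}                       (s = \<infinity>),
   of a measurable g \<ge> 0, which for s < \<infinity> equals ( \<integral>_0^\<infinity> (t^{1/p} g*(t))^s dt/t )^{1/s} with
   g* the decreasing rearrangement.  Values in [0,\<infinity>] are allowed so that
   the definition can be iterated in mixed norms. *)
definition lorentz_norm :: "'a measure \<Rightarrow> real \<Rightarrow> ennreal \<Rightarrow> ('a \<Rightarrow> ennreal) \<Rightarrow> ennreal" where
  "lorentz_norm M p s g =
    (if s = \<infinity> then
       (SUP t\<in>{0<..}. ennreal t * epowr (distribution_function M g t) (1 / p))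
     else
       ennreal (p powr (1 / enn2real s)) *
       epowr (\<integral>\<^sup>+ t\<in>{0<..}. epowr (ennreal t * epowr (distribution_function M g t) (1 / p))
                                 (enn2real s) * ennreal (1 / t) \<partial>lborel)
             (1 / enn2real s))"

abbreviation lorentz_norm_complex ::
    "'a measure \<Rightarrow> real \<Rightarrow> ennreal \<Rightarrow> ('a \<Rightarrow> complex) \<Rightarrow> ennreal" where
  "lorentz_norm_complex M p s f \<equiv> lorentz_norm M p s (\<lambda>x. ennreal (cmod (f x)))"

section \<open>The space \<open>X_p\<close>\<close>

definition mixed_lorentz_xy ::
    "real \<Rightarrow> ennreal \<Rightarrow> ('a::euclidean_space \<times> 'b::euclidean_space \<Rightarrow> complex) \<Rightarrow> ennreal" where
  "mixed_lorentz_xy p s f =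
     lorentz_norm lborel p s (\<lambda>x. lorentz_norm_complex lborel p s (\<lambda>y. f (x, y)))"

definition mixed_lorentz_yx ::
    "real \<Rightarrow> ennreal \<Rightarrow> ('a::euclidean_space \<times> 'b::euclidean_space \<Rightarrow> complex) \<Rightarrow> ennreal" where
  "mixed_lorentz_yx p s f =
     lorentz_norm lborel p s (\<lambda>y. lorentz_norm_complex lborel p s (\<lambda>x. f (x, y)))"

(* Measurability of the two summands must be demanded explicitly: emeasure is 0 on
   non-measurable sets. *)
definition mixed_lorentz_sum ::
    "real \<Rightarrow> ennreal \<Rightarrow> ('a::euclidean_space \<times> 'b::euclidean_space \<Rightarrow> complex) \<Rightarrow> ennreal" where
  "mixed_lorentz_sum p s f =
     Inf {mixed_lorentz_xy p s f1 + mixed_lorentz_yx p s f2 | f1 f2.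
            f1 \<in> borel_measurable lborel \<and> f2 \<in> borel_measurable lborel \<and>
            (AE z in lborel. f z = f1 z + f2 z)}"

definition X_norm ::
    "real \<Rightarrow> ('a::euclidean_space \<times> 'b::euclidean_space \<Rightarrow> complex) \<Rightarrow> ennreal" where
  "X_norm p f =
     (if real (min DIM('a) DIM('b)) < real DIM('a \<times> 'b) / 2
      then lorentz_norm_complex lborel p 1 f
      else mixed_lorentz_sum p 1 f)"

section \<open>Symmetric Schwartz functions\<close>

definition block_orthogonal_group ::
    "('a::euclidean_space \<times> 'b::euclidean_space \<Rightarrow> 'a \<times> 'b) set" where
  "block_orthogonal_group =
     {map_prod A B | A B. orthogonal_transformation A \<and> orthogonal_transformation B}"

definition block_symmetric ::
    "('a::euclidean_space \<times> 'b::euclidean_space \<Rightarrow> complex) \<Rightarrow> bool" where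
  "block_symmetric f \<longleftrightarrow> (\<forall>A\<in>block_orthogonal_group. f \<circ> A = f)"

fun iterated_partial ::
    "'a::euclidean_space list \<Rightarrow> ('a \<Rightarrow> complex) \<Rightarrow> 'a \<Rightarrow> complex" where
  "iterated_partial [] f = f"
| "iterated_partial (b # bs) f = (\<lambda>x. frechet_derivative (iterated_partial bs f) (at x) b)"

(* Differentiability of all iterated partial derivatives amounts to smoothness. *)
definition schwartz :: "('a::euclidean_space \<Rightarrow> complex) \<Rightarrow> bool" where
  "schwartz f \<longleftrightarrow>
     (\<forall>bs. set bs \<subseteq> Basis \<longrightarrow>
        (\<forall>x. iterated_partial bs f differentiable (at x)) \<and>
        (\<forall>N::nat. bounded (range (\<lambda>x. norm x ^ N * cmod (iterated_partial bs f x)))))"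

section \<open>Fourier transform and surface measure\<close>

definition fourier :: "('a::euclidean_space \<Rightarrow> complex) \<Rightarrow> 'a \<Rightarrow> complex" where
  "fourier f \<xi> = (\<integral>x. f x * exp (- \<i> * complex_of_real (\<xi> \<bullet> x)) \<partial>lborel)"

(* Surface measure through cones (polar coordinates):
   \<sigma>(E) = d * |{r \<omega> | 0 < r < 1, \<omega> \<in> E}|. *)
definition surface_measure :: "'a::euclidean_space measure" where
  "surface_measure =
     scale_measure (of_nat DIM('a))
       (distr (restrict_space lborel (ball 0 1 - {0})) (restrict_space borel (sphere 0 1))
          (\<lambda>x. x /\<^sub>R norm x))"

end

theory Submission
  imports Defs
begin

text \<open>
  Write \<open>a\<close>, \<open>b\<close> for the dimensions of the two blocks, \<open>m = min a b\<close>, \<open>q = 2m/(m-1)\<close> and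
  \<open>p = 2m/(m+1)\<close>; the exponents \<open>p\<close> and \<open>q\<close> are conjugate. The theorem follows from a pointwise
  bound on \<open>fourier f\<close>, obtained by putting absolute values inside the integral once the rotational
  symmetry has been used up.

  \<^item> \<^bold>\<open>Averaging over rotations.\<close> For a block-symmetric \<open>f\<close> the transform is block-symmetric too, so it
    may be averaged over the rotations of \<open>\<xi>\<close> and of \<open>\<eta>\<close>. By Fubini the exponential is replaced by
    \<open>J(|\<xi>| x) J(|\<eta>| y)\<close>, where \<open>J\<close> is the Fourier transform of the uniform probability on the
    sphere (\<open>fourier_block_average\<close>).

  \<^item> \<^bold>\<open>Decay of \<open>J\<close>.\<close> As a function of \<open>t = |z|\<close>, \<open>J\<close> solves \<open>J'' + (n/t) J' + J = 0\<close> with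
    \<open>n = a - 1\<close>; this expresses the rotation invariance of the sphere
    (\<open>sphere_rotation_identity\<close>). An energy estimate for the equation gives
    \<open>|J(t)| \<le> C t\<^bsup>-n/2\<^esup>\<close> in every dimension at once (\<open>bessel_equation_decay\<close>, \<open>sphere_kernel_decay\<close>).

  \<^item> \<^bold>\<open>Lorentz duality.\<close> The majorant \<open>decay(\<rho> x)\<close> lies in weak \<open>L\<^sup>q\<close> with quasi-norm of order
    \<open>\<rho>\<^bsup>-a/q\<^esup>\<close> as soon as \<open>q \<ge> 2a/(a-1)\<close>, and in \<open>L\<^sup>q\<close> proper if the inequality is strict. If
    \<open>a \<noteq> b\<close>, one factor of the product kernel is weak \<open>L\<^sup>q\<close> and the other is \<open>L\<^sup>q\<close>, so the product is
    weak \<open>L\<^sup>q\<close> on the whole space and pairs with \<open>L\<^bsup>p,1\<^esup>\<close>. If \<open>a = b\<close>, both factors are only weak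
    \<open>L\<^sup>q\<close>; the pairing has to be done one variable at a time, which is what the mixed norms are for.
    In both cases (\<open>X_norm_holder\<close>)
    \<open>|fourier f (\<xi>, \<eta>)| \<le> C \<parallel>f\<parallel> |\<xi>|\<^bsup>-a/q\<^esup> |\<eta>|\<^bsup>-b/q\<^esup>\<close>, the norm being that of \<open>X\<^sub>p\<close>.

  \<^item> \<^bold>\<open>Size on the sphere.\<close> On the unit sphere \<open>|\<xi>|\<close> and \<open>|\<eta>|\<close> are not both small, and the part of
    the sphere where \<open>|\<xi>| \<le> \<epsilon>\<close> has measure of order \<open>\<epsilon>\<^sup>a\<close>. Hence \<open>|\<xi>|\<^bsup>-a/q\<^esup>\<close>, and likewise
    \<open>|\<eta>|\<^bsup>-b/q\<^esup>\<close>, is in weak \<open>L\<^sup>q\<close> of the sphere (\<open>weak_norm_of_axis_singularity\<close>).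
\<close>

section \<open>Rotation invariance of Lebesgue measure\<close>

lemma emeasure_unit_ball_nontrivial:
  "emeasure lborel (ball (0::'a::euclidean_space) 1) \<noteq> 0"
  "emeasure lborel (ball (0::'a::euclidean_space) 1) \<noteq> \<infinity>"
proof -
  have "emeasure lborel (ball (0::'a) 1) = ennreal (unit_ball_vol DIM('a))" by (simp add: emeasure_ball)
  moreover have "ennreal (unit_ball_vol (real DIM('a))) \<noteq> 0"
    using unit_ball_vol_pos[of "real DIM('a)"] by (metis ennreal_eq_0_iff not_less of_nat_0_le_iff)
  ultimately show "emeasure lborel (ball (0::'a::euclidean_space) 1) \<noteq> 0"
    "emeasure lborel (ball (0::'a::euclidean_space) 1) \<noteq> \<infinity>" by simp_all
qed

text \<open>
  Uniqueness of Haar measure, by the classical trick of evaluating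
  \<open>\<integral>\<integral> 1\<^sub>A(x) 1\<^sub>B(x + y) dx dy\<close> in both orders: translation invariance turns it into
  \<open>M(A) \<lambda>(B)\<close> and into \<open>\<lambda>(A) M(B)\<close>. The unit ball \<open>B\<close> fixes the normalisation.
\<close>
lemma translation_invariant_eq_lborel:
  fixes M :: "'a::euclidean_space measure"
  assumes sets: "sets M = sets borel" and sf: "sigma_finite_measure M"
    and inv: "\<And>z. distr M borel ((+) z) = M"
    and ball: "emeasure M (ball 0 1) = emeasure lborel (ball (0::'a) 1)"
  shows "M = lborel"
proof (rule measure_eqI)
  show "sets M = sets lborel" by (simp add: sets)
  interpret M: sigma_finite_measure M by fact
  interpret P: pair_sigma_finite M "lborel :: 'a measure" ..
  note sets [measurable_cong]
  define B where "B = ball (0::'a) 1"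
  have B_borel [measurable]: "B \<in> sets borel" by (simp add: B_def)
  have reflect: "(\<integral>\<^sup>+ y. indicator A (x - y) \<partial>lborel) = emeasure lborel A"
    if [measurable]: "A \<in> sets borel" for A and x :: 'a
  proof -
    have "distr lborel borel ((-) x) = lborel"
      using lborel_affine[of "-1" x] by (simp add: density_1)
    then have "emeasure lborel A = (\<integral>\<^sup>+ y. indicator A y \<partial>distr lborel borel ((-) x))"
      by simp
    also have "\<dots> = (\<integral>\<^sup>+ y. indicator A (x - y) \<partial>lborel)"
      by (subst nn_integral_distr) auto
    finally show ?thesis ..
  qed
  have shift: "(\<integral>\<^sup>+ x. f (z + x) \<partial>N) = (\<integral>\<^sup>+ x. f x \<partial>N)"
    if "distr N borel ((+) z) = N" and [measurable]: "f \<in> borel_measurable borel" and [measurable_cong]: "sets N = sets borel"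
    for N :: "'a measure" and f z
  proof -
    have "(\<integral>\<^sup>+ x. f x \<partial>N) = (\<integral>\<^sup>+ x. f x \<partial>distr N borel ((+) z))" by (simp add: that(1))
    also have "\<dots> = (\<integral>\<^sup>+ x. f (z + x) \<partial>N)" by (subst nn_integral_distr) measurable
    finally show ?thesis ..
  qed
  fix A assume "A \<in> sets M"
  then have A[measurable]: "A \<in> sets borel" by (simp add: sets)
  have B_shift: "(\<integral>\<^sup>+ y. indicator B (x + y) \<partial>lborel) = emeasure lborel B" for x
    using shift[of lborel x "indicator B", OF lborel_distr_plus borel_measurable_indicator] by (simp add: B_borel)
  have "emeasure M A * emeasure lborel B =
      (\<integral>\<^sup>+ x. indicator A x * (\<integral>\<^sup>+ y. indicator B (x + y) \<partial>lborel) \<partial>M)"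
    unfolding B_shift by (subst nn_integral_multc) (auto simp: sets)
  also have "\<dots> = (\<integral>\<^sup>+ x. \<integral>\<^sup>+ y. indicator A x * indicator B (x + y) \<partial>lborel \<partial>M)"
    by (intro nn_integral_cong nn_integral_cmult[symmetric]) measurable
  also have "\<dots> = (\<integral>\<^sup>+ y. \<integral>\<^sup>+ x. indicator A x * indicator B (x + y) \<partial>M \<partial>lborel)"
    by (subst P.Fubini') auto
  also have "\<dots> = (\<integral>\<^sup>+ y. \<integral>\<^sup>+ x. indicator A (x - y) * indicator B x \<partial>M \<partial>lborel)"
  proof (rule nn_integral_cong)
    fix y :: 'a
    show "(\<integral>\<^sup>+ x. indicator A x * indicator B (x + y) \<partial>M) = (\<integral>\<^sup>+ x. indicator A (x - y) * indicator B x \<partial>M)"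
      using shift[of M "-y" "\<lambda>x. indicator A x * indicator B (x + y)"] inv sets by simp
  qed
  also have "\<dots> = (\<integral>\<^sup>+ x. \<integral>\<^sup>+ y. indicator A (x - y) * indicator B x \<partial>lborel \<partial>M)"
    by (subst P.Fubini') auto
  also have "\<dots> = (\<integral>\<^sup>+ x. emeasure lborel A * indicator B x \<partial>M)"
    by (rule nn_integral_cong) (subst nn_integral_multc, auto simp: reflect)
  also have "\<dots> = emeasure lborel A * emeasure lborel B"
    using ball B_borel by (subst nn_integral_cmult) (auto simp: sets B_def[symmetric])
  finally have eq: "emeasure M A * emeasure lborel B = emeasure lborel A * emeasure lborel B" .
  have "emeasure lborel B \<noteq> 0" "emeasure lborel B \<noteq> \<infinity>"
    using emeasure_unit_ball_nontrivial[where ?'a='a] by (simp_all only: B_def not_False_eq_True)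
  then show "emeasure M A = emeasure lborel A"
    using eq by (simp add: mult.commute[of _ "emeasure lborel B"] ennreal_mult_cancel_left)
qed

text \<open>
  The image of Lebesgue measure under an orthogonal map is again translation invariant and gives the
  unit ball the same volume.
\<close>
lemma distr_lborel_orthogonal_transformation:
  fixes T :: "'a::euclidean_space \<Rightarrow> 'a"
  assumes T: "orthogonal_transformation T"
  shows "distr lborel borel T = lborel"
proof (rule translation_invariant_eq_lborel)
  have lin: "linear T" using T by (simp add: orthogonal_transformation_linear)
  have meas[measurable]: "T \<in> borel_measurable borel"
    using lin by (intro borel_measurable_continuous_onI linear_continuous_on linear_conv_bounded_linear[THEN iffD1])
  obtain S where S: "orthogonal_transformation S" "\<And>x. T (S x) = x" "\<And>x. S (T x) = x"
    using orthogonal_transformation_inv[OF T] orthogonal_transformation_bij[OF T]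
    by (metis bij_betw_def inv_f_f surj_f_inv_f)
  have pre: "T -` ball 0 r = ball 0 r" for r
    using T by (auto simp: orthogonal_transformation_norm)
  show "sets (distr lborel borel T) = sets borel" by simp
  show "sigma_finite_measure (distr lborel borel T)"
  proof
    show "\<exists>A. countable A \<and> A \<subseteq> sets (distr lborel borel T) \<and> \<Union> A = space (distr lborel borel T) \<and>
        (\<forall>a\<in>A. emeasure (distr lborel borel T) a \<noteq> \<infinity>)"
      by (rule exI[of _ "range (\<lambda>n::nat. ball 0 (real n))"])
         (auto simp: emeasure_distr pre emeasure_ball intro: reals_Archimedean2)
  qed
  show "emeasure (distr lborel borel T) (ball 0 1) = emeasure lborel (ball (0::'a) 1)"
    by (simp add: emeasure_distr pre)
  fix z :: 'a
  have "distr (distr lborel borel T) borel ((+) z) = distr lborel borel ((+) z \<circ> T)"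
    by (subst distr_distr) auto
  also have "(+) z \<circ> T = T \<circ> (+) (S z)"
    using lin by (auto simp: fun_eq_iff linear_add S)
  also have "distr lborel borel \<dots> = distr (distr lborel borel ((+) (S z))) borel T"
    by (subst distr_distr) auto
  finally show "distr (distr lborel borel T) borel ((+) z) = distr lborel borel T"
    by (simp add: lborel_distr_plus)
qed

text \<open>The reflection in the hyperplane orthogonal to \<open>a - b\<close> exchanges \<open>a\<close> and \<open>b\<close>.\<close>
lemma orthogonal_transformation_between_equal_norms:
  fixes a b :: "'a::euclidean_space"
  assumes "norm a = norm b"
  obtains T where "orthogonal_transformation T" "T a = b"
proof (cases "a = b")
  case True
  then show ?thesis using that[of "\<lambda>x. x"] by (simp add: orthogonal_transformation)
next
  case False
  define v where "v = a - b"
  define T where "T x = x - (2 * (x \<bullet> v) / (v \<bullet> v)) *\<^sub>R v" for x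
  have v: "v \<bullet> v \<noteq> 0" using False by (simp add: v_def)
  have "linear T"
    unfolding T_def by (intro linearI) (auto simp: algebra_simps inner_add_left add_divide_distrib)
  moreover have "norm (T x) = norm x" for x
  proof -
    have "T x \<bullet> T x = x \<bullet> x"
      using v by (simp add: T_def inner_diff_left inner_diff_right inner_commute[of v x] field_simps power2_eq_square)
    then show ?thesis by (simp add: norm_eq_sqrt_inner)
  qed
  moreover have "T a = b"
  proof -
    have "a \<bullet> a = b \<bullet> b" using assms by (simp add: norm_eq_sqrt_inner)
    then have "2 * (a \<bullet> v) = v \<bullet> v"
      by (simp add: v_def inner_diff_left inner_diff_right inner_commute)
    then show ?thesis using v by (simp add: T_def v_def[symmetric]) (simp add: v_def)
  qed
  ultimately show ?thesis using that by (auto simp: orthogonal_transformation)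
qed

section \<open>The uniform distribution on the sphere\<close>
lemma has_real_derivative_integral_bounded:
  fixes f f' :: "real \<Rightarrow> 'a \<Rightarrow> real"
  assumes "finite_measure M"
    and int: "\<And>t. integrable M (f t)" and meas: "\<And>t. f' t \<in> borel_measurable M"
    and deriv: "\<And>t x. ((\<lambda>t. f t x) has_real_derivative f' t x) (at t)"
    and bound: "AE x in M. \<forall>t. \<bar>f' t x\<bar> \<le> B"
  shows "((\<lambda>t. \<integral>x. f t x \<partial>M) has_real_derivative (\<integral>x. f' t x \<partial>M)) (at t)"
proof -
  interpret finite_measure M by fact
  have "((\<lambda>h. ((\<integral>x. f (t + h) x \<partial>M) - (\<integral>x. f t x \<partial>M)) / h) \<longlongrightarrow> (\<integral>x. f' t x \<partial>M)) (at 0)"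
    unfolding tendsto_at_iff_sequentially comp_def
  proof (intro allI impI)
    fix X :: "nat \<Rightarrow> real" assume nz: "\<forall>i. X i \<in> UNIV - {0}" and X: "X \<longlonglongrightarrow> 0"
    have quot: "((\<integral>x. f (t + X i) x \<partial>M) - (\<integral>x. f t x \<partial>M)) / X i = (\<integral>x. (f (t + X i) x - f t x) / X i \<partial>M)" for i
      using int by simp
    show "(\<lambda>i. ((\<integral>x. f (t + X i) x \<partial>M) - (\<integral>x. f t x \<partial>M)) / X i) \<longlonglongrightarrow> (\<integral>x. f' t x \<partial>M)"
      unfolding quot
    proof (rule integral_dominated_convergence[where w="\<lambda>_. B"])
      show "(\<lambda>x. (f (t + X i) x - f t x) / X i) \<in> borel_measurable M" for i
        using int by (intro borel_measurable_divide borel_measurable_diff) auto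
      show "AE x in M. (\<lambda>i. (f (t + X i) x - f t x) / X i) \<longlonglongrightarrow> f' t x"
      proof (rule AE_I2)
        fix x
        have "((\<lambda>h. (f (t + h) x - f t x) / h) \<longlongrightarrow> f' t x) (at 0)"
          using deriv[of x t] by (simp add: DERIV_def)
        then show "(\<lambda>i. (f (t + X i) x - f t x) / X i) \<longlonglongrightarrow> f' t x"
          using nz X unfolding tendsto_at_iff_sequentially comp_def by blast
      qed
      show "AE x in M. norm ((f (t + X i) x - f t x) / X i) \<le> B" for i
        using bound
      proof eventually_elim
        case (elim x)
        have "norm (f (t + X i) x - f t x) \<le> B * norm (t + X i - t)"
          by (rule field_differentiable_bound[where S=UNIV and f="\<lambda>t. f t x" and f'="\<lambda>t. f' t x"])
             (use elim deriv in auto)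
        then show ?case using nz by (simp add: field_simps)
      qed
    qed (use meas in auto)
  qed
  then show ?thesis by (simp add: DERIV_def)
qed

text \<open>
  Normalising a uniform point of the unit ball yields the rotation-invariant probability on the unit
  sphere. It is kept as a measure on the whole space, so that it combines with Borel functions
  without restriction; it sees only vectors of norm \<open>1\<close> (\<open>AE_sphere_uniform\<close>), the value
  \<open>sgn 0 = 0\<close> being attained with probability \<open>0\<close>.
\<close>
definition sphere_uniform :: "'a::euclidean_space measure" where
  "sphere_uniform = distr (uniform_measure lborel (ball 0 1)) borel sgn"

lemma sgn_measurable_borel [measurable]: "(sgn :: 'a::euclidean_space \<Rightarrow> 'a) \<in> borel_measurable borel"
  unfolding sgn_div_norm[abs_def] by measurable

lemma sets_sphere_uniform [simp, measurable_cong]: "sets sphere_uniform = sets borel"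
  and space_sphere_uniform [simp]: "space sphere_uniform = UNIV"
  by (simp_all add: sphere_uniform_def)

lemma emeasure_sphere_uniform_UNIV: "emeasure (sphere_uniform :: 'a::euclidean_space measure) UNIV = 1"
proof -
  have "emeasure (sphere_uniform :: 'a measure) UNIV = emeasure (uniform_measure lborel (ball (0::'a) 1)) UNIV"
    by (simp add: sphere_uniform_def emeasure_distr)
  also have "\<dots> = 1"
    using emeasure_unit_ball_nontrivial[where ?'a='a]
    by (subst emeasure_uniform_measure) (auto simp: ennreal_divide_self less_top)
  finally show ?thesis .
qed

lemma finite_measure_sphere_uniform: "finite_measure sphere_uniform"
  by (rule finite_measureI) (simp add: emeasure_sphere_uniform_UNIV)

lemma measure_sphere_uniform_UNIV: "measure sphere_uniform UNIV = 1"
  by (simp add: measure_def emeasure_sphere_uniform_UNIV)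

lemma AE_sphere_uniform: "AE \<omega> in sphere_uniform. norm (\<omega> :: 'a::euclidean_space) = 1"
proof -
  have "AE u in lborel. u \<noteq> (0 :: 'a)" by (rule AE_lborel_singleton)
  then have "AE u in lborel. u \<in> ball (0::'a) 1 \<longrightarrow> norm (sgn u) = 1"
    by eventually_elim (simp add: norm_sgn)
  then have "AE u in uniform_measure lborel (ball (0::'a) 1). norm (sgn u) = 1"
    by (intro AE_uniform_measureI) auto
  then show ?thesis
    unfolding sphere_uniform_def by (subst AE_distr_iff) auto
qed

lemma orthogonal_transformation_borel:
  fixes T :: "'a::euclidean_space \<Rightarrow> 'a"
  shows "orthogonal_transformation T \<Longrightarrow> T \<in> borel_measurable borel"
  by (intro borel_measurable_continuous_onI linear_continuous_on linear_conv_bounded_linear[THEN iffD1]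
      orthogonal_transformation_linear)

lemma distr_sphere_uniform_orthogonal:
  fixes T :: "'a::euclidean_space \<Rightarrow> 'a"
  assumes T: "orthogonal_transformation T"
  shows "distr sphere_uniform borel T = sphere_uniform"
proof -
  note [measurable] = orthogonal_transformation_borel[OF T]
  let ?B = "ball (0::'a) 1" and ?U = "uniform_measure lborel (ball (0::'a) 1)"
  have "distr ?U borel T = ?U"
  proof (rule measure_eqI)
    fix A assume "A \<in> sets (distr ?U borel T)"
    then have [measurable]: "A \<in> sets borel" by simp
    have "?B \<inter> T -` A = T -` (?B \<inter> A)" using T by (auto simp: orthogonal_transformation_norm)
    then have "emeasure lborel (?B \<inter> T -` A) = emeasure (distr lborel borel T) (?B \<inter> A)"
      by (simp add: emeasure_distr)
    also have "\<dots> = emeasure lborel (?B \<inter> A)" by (simp add: distr_lborel_orthogonal_transformation[OF T])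
    moreover have "T -` A \<in> sets borel" using measurable_sets_borel[of T borel A] by simp
    ultimately show "emeasure (distr ?U borel T) A = emeasure ?U A"
      by (simp add: emeasure_distr)
  qed simp
  moreover have "T \<circ> sgn = sgn \<circ> T"
    using T by (auto simp: fun_eq_iff sgn_div_norm orthogonal_transformation_norm linear_cmul
        dest: orthogonal_transformation_linear)
  moreover have "distr (distr ?U borel sgn) borel T = distr ?U borel (T \<circ> sgn)"
    by (intro distr_distr) auto
  moreover have "distr (distr ?U borel T) borel sgn = distr ?U borel (sgn \<circ> T)"
    by (intro distr_distr) auto
  ultimately show ?thesis
    unfolding sphere_uniform_def by simp
qed

lemma integral_sphere_uniform_orthogonal:
  fixes T :: "'a::euclidean_space \<Rightarrow> 'a" and f :: "'a \<Rightarrow> 'b::{banach, second_countable_topology}"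
  assumes T: "orthogonal_transformation T" and [measurable]: "f \<in> borel_measurable borel"
  shows "(\<integral>\<omega>. f (T \<omega>) \<partial>sphere_uniform) = (\<integral>\<omega>. f \<omega> \<partial>sphere_uniform)"
proof -
  have "T \<in> measurable sphere_uniform borel"
    using orthogonal_transformation_borel[OF T] by simp
  then have "(\<integral>\<omega>. f \<omega> \<partial>distr sphere_uniform borel T) = (\<integral>\<omega>. f (T \<omega>) \<partial>sphere_uniform)"
    by (intro integral_distr) auto
  then show ?thesis by (simp add: distr_sphere_uniform_orthogonal[OF T])
qed

lemma integrable_sphere_uniform:
  fixes f :: "'a::euclidean_space \<Rightarrow> 'b::{banach, second_countable_topology}"
  assumes [measurable]: "f \<in> borel_measurable borel" and "\<And>\<omega>. norm \<omega> = 1 \<Longrightarrow> norm (f \<omega>) \<le> B"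
  shows "integrable sphere_uniform f"
proof -
  interpret finite_measure "sphere_uniform :: 'a measure" by (rule finite_measure_sphere_uniform)
  show ?thesis
    using AE_sphere_uniform assms(2) by (intro integrable_const_bound[where B=B]) auto
qed

lemma plane_rotation:
  fixes e j :: "'a::euclidean_space"
  assumes e: "e \<in> Basis" and j: "j \<in> Basis" and "e \<noteq> j"
  obtains T where "orthogonal_transformation T"
    "\<And>x. T x \<bullet> e = cos \<theta> * (x \<bullet> e) - sin \<theta> * (x \<bullet> j)"
    "\<And>x. T x \<bullet> j = sin \<theta> * (x \<bullet> e) + cos \<theta> * (x \<bullet> j)"
proof -
  define T where "T x = x + ((cos \<theta> - 1) * (x \<bullet> e) - sin \<theta> * (x \<bullet> j)) *\<^sub>R e
      + (sin \<theta> * (x \<bullet> e) + (cos \<theta> - 1) * (x \<bullet> j)) *\<^sub>R j" for x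
  have ip: "e \<bullet> e = 1" "j \<bullet> j = 1" "e \<bullet> j = 0" "j \<bullet> e = 0"
    using assms by (auto simp: inner_Basis)
  have "linear T"
    unfolding T_def by (intro linearI) (auto simp: algebra_simps inner_add_left)
  moreover have "norm (T x) = norm x" for x
  proof -
    define p q where "p = x \<bullet> e" and "q = x \<bullet> j"
    have "T x \<bullet> T x = x \<bullet> x + 2 * ((cos \<theta> - 1) * p - sin \<theta> * q) * p + 2 * (sin \<theta> * p + (cos \<theta> - 1) * q) * q
       + ((cos \<theta> - 1) * p - sin \<theta> * q)\<^sup>2 + (sin \<theta> * p + (cos \<theta> - 1) * q)\<^sup>2"
      by (simp add: T_def inner_add_left inner_add_right ip inner_commute[of e x] inner_commute[of j x]
          p_def[symmetric] q_def[symmetric] power2_eq_square algebra_simps)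
    also have "x \<bullet> x + 2 * ((c - 1) * p - s * q) * p + 2 * (s * p + (c - 1) * q) * q
       + ((c - 1) * p - s * q)\<^sup>2 + (s * p + (c - 1) * q)\<^sup>2
       = x \<bullet> x + (p\<^sup>2 + q\<^sup>2) * (s\<^sup>2 + c\<^sup>2 - 1)" for c s
      by (simp add: power2_eq_square algebra_simps)
    finally show ?thesis by (simp add: norm_eq_sqrt_inner)
  qed
  ultimately have "orthogonal_transformation T" by (simp add: orthogonal_transformation)
  then show ?thesis
    by (rule that) (simp_all add: T_def inner_add_left ip algebra_simps)
qed

text \<open>
  The mean of \<open>\<omega>\<^sub>j sin(t \<omega>\<^sub>e)\<close> does not change when \<open>\<omega>\<close> is rotated by an angle \<open>\<theta>\<close> in the
  plane of \<open>e\<close> and \<open>j\<close>. The integrand below is the derivative of the rotated function at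
  \<open>\<theta> = 0\<close>; this is integration by parts on the sphere along a rotation field.
\<close>
lemma sphere_rotation_identity:
  fixes e j :: "'a::euclidean_space"
  assumes e: "e \<in> Basis" and j: "j \<in> Basis" and "e \<noteq> j"
  shows "(\<integral>\<omega>. (\<omega> \<bullet> e) * sin (t * (\<omega> \<bullet> e)) - t * (\<omega> \<bullet> j)\<^sup>2 * cos (t * (\<omega> \<bullet> e)) \<partial>sphere_uniform) = 0"
proof -
  define u v where "u \<theta> \<omega> = cos \<theta> * (\<omega> \<bullet> e) - sin \<theta> * (\<omega> \<bullet> j)"
    and "v \<theta> \<omega> = sin \<theta> * (\<omega> \<bullet> e) + cos \<theta> * (\<omega> \<bullet> j)" for \<theta> and \<omega> :: 'a
  define f where "f \<theta> \<omega> = v \<theta> \<omega> * sin (t * u \<theta> \<omega>)" for \<theta> \<omega>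
  define f' where "f' \<theta> \<omega> = u \<theta> \<omega> * sin (t * u \<theta> \<omega>) - t * (v \<theta> \<omega>)\<^sup>2 * cos (t * u \<theta> \<omega>)" for \<theta> \<omega>
  have uv: "\<bar>u \<theta> \<omega>\<bar> \<le> 2" "\<bar>v \<theta> \<omega>\<bar> \<le> 2" if "norm \<omega> = 1" for \<theta> \<omega>
  proof -
    have *: "\<bar>\<omega> \<bullet> e\<bar> \<le> 1" "\<bar>\<omega> \<bullet> j\<bar> \<le> 1"
      using Basis_le_norm[OF e, of \<omega>] Basis_le_norm[OF j, of \<omega>] that by auto
    have "\<bar>c * a\<bar> \<le> 1" if "\<bar>c\<bar> \<le> 1" "\<bar>a\<bar> \<le> 1" for a c :: real
      using that by (simp add: abs_mult mult_le_one)
    note this[OF abs_cos_le_one[of \<theta>] *(1)] this[OF abs_cos_le_one[of \<theta>] *(2)]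
      this[OF abs_sin_le_one[of \<theta>] *(1)] this[OF abs_sin_le_one[of \<theta>] *(2)]
    then show "\<bar>u \<theta> \<omega>\<bar> \<le> 2" "\<bar>v \<theta> \<omega>\<bar> \<le> 2" unfolding u_def v_def by linarith+
  qed
  have meas [measurable]: "f \<theta> \<in> borel_measurable borel" "f' \<theta> \<in> borel_measurable borel" for \<theta>
    unfolding f_def[abs_def] f'_def[abs_def] u_def v_def by measurable
  have const: "(\<integral>\<omega>. f \<theta> \<omega> \<partial>sphere_uniform) = (\<integral>\<omega>. f 0 \<omega> \<partial>sphere_uniform)" for \<theta>
  proof -
    obtain T where "orthogonal_transformation T"
      "\<And>x. T x \<bullet> e = cos \<theta> * (x \<bullet> e) - sin \<theta> * (x \<bullet> j)"
      "\<And>x. T x \<bullet> j = sin \<theta> * (x \<bullet> e) + cos \<theta> * (x \<bullet> j)"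
      using plane_rotation[OF assms, where \<theta>=\<theta>] by blast
    then show ?thesis
      using integral_sphere_uniform_orthogonal[of T "f 0"] by (simp add: f_def u_def v_def)
  qed
  have "((\<lambda>\<theta>. \<integral>\<omega>. f \<theta> \<omega> \<partial>sphere_uniform) has_real_derivative (\<integral>\<omega>. f' 0 \<omega> \<partial>sphere_uniform)) (at 0)"
  proof (rule has_real_derivative_integral_bounded[OF finite_measure_sphere_uniform])
    show "integrable sphere_uniform (f \<theta>)" for \<theta>
    proof (rule integrable_sphere_uniform)
      show "norm (f \<theta> \<omega>) \<le> 2 * 1" if "norm \<omega> = 1" for \<omega>
        unfolding f_def real_norm_def abs_mult by (intro mult_mono uv that) auto
    qed simp
    show "((\<lambda>\<theta>. f \<theta> \<omega>) has_real_derivative f' \<theta> \<omega>) (at \<theta>)" for \<theta> \<omega>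
      unfolding f_def f'_def u_def v_def
      by (auto intro!: derivative_eq_intros simp: power2_eq_square algebra_simps)
    show "AE \<omega> in sphere_uniform. \<forall>\<theta>. \<bar>f' \<theta> \<omega>\<bar> \<le> 2 * 1 + \<bar>t\<bar> * 2\<^sup>2 * 1"
      using AE_sphere_uniform
    proof eventually_elim
      case (elim \<omega>)
      show ?case
      proof
        fix \<theta>
        have "\<bar>u \<theta> \<omega> * sin (t * u \<theta> \<omega>)\<bar> \<le> 2 * 1"
          unfolding abs_mult by (intro mult_mono uv elim) auto
        moreover have "\<bar>t * (v \<theta> \<omega>)\<^sup>2 * cos (t * u \<theta> \<omega>)\<bar> \<le> \<bar>t\<bar> * 2\<^sup>2 * 1"
          unfolding abs_mult power_abs by (intro mult_mono power_mono uv elim) auto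
        ultimately show "\<bar>f' \<theta> \<omega>\<bar> \<le> 2 * 1 + \<bar>t\<bar> * 2\<^sup>2 * 1"
          unfolding f'_def by linarith
      qed
    qed
  qed simp
  moreover have "((\<lambda>\<theta>. \<integral>\<omega>. f \<theta> \<omega> \<partial>sphere_uniform) has_real_derivative 0) (at 0)"
    by (subst const) simp
  ultimately have "(\<integral>\<omega>. f' 0 \<omega> \<partial>sphere_uniform) = 0" by (rule DERIV_unique)
  then show ?thesis by (simp add: f'_def u_def v_def)
qed

section \<open>Decay of the Fourier transform of the sphere\<close>
text \<open>
  The equation is that of \<open>t\<^bsup>-\<nu>\<^esup> J\<^sub>\<nu>(t)\<close> with \<open>n = 2\<nu> + 1\<close>, where \<open>J\<^sub>\<nu>\<close> is the Bessel function. The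
  substitution \<open>w = t\<^bsup>n/2\<^esup> J\<close> removes the damping up to an integrable error, so the energy of \<open>w\<close>
  stays bounded.
\<close>
lemma bessel_equation_decay:
  fixes J J1 J2 :: "real \<Rightarrow> real" and n :: real
  assumes n: "n \<ge> 1"
    and J: "\<And>t. (J has_real_derivative J1 t) (at t)" and J1: "\<And>t. (J1 has_real_derivative J2 t) (at t)"
    and ode: "\<And>t. t > 0 \<Longrightarrow> J2 t = - J t - n / t * J1 t"
    and bd: "\<bar>J n\<bar> \<le> 1" "\<bar>J1 n\<bar> \<le> 1" and t: "t \<ge> n"
  shows "\<bar>J t\<bar> \<le> sqrt (6 * exp 1 * n powr n) * t powr (- (n / 2))"
proof -
  \<comment> \<open>The cross term in \<open>Q\<close> cancels the part of order \<open>1/t\<close> in the derivative of the energy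
    \<open>t\<^bsup>n\<^esup> (J\<^sup>2 + J'\<^sup>2)\<close>. What is left is \<open>- n t\<^bsup>n-2\<^esup> J J'\<close>, for \<open>t \<ge> n\<close> at most \<open>n/t\<^sup>2\<close> times the
    energy \<open>t\<^bsup>n\<^esup> Q\<close>, and this is compensated by the derivative of \<open>exp(n/t)\<close>.\<close>
  define Q where "Q t = (J t)\<^sup>2 + (J1 t)\<^sup>2 + n * (J t * J1 t) / t" for t
  define F where "F t = t powr n * Q t * exp (n / t)" for t
  have F_deriv: "(F has_real_derivative
      (t powr n * exp (n / t) * (- (n / t\<^sup>2) * ((J t)\<^sup>2 + (J1 t)\<^sup>2 + (1 + n / t) * (J t * J1 t))))) (at t)"
    if "t > 0" for t
  proof -
    have Q': "(Q has_real_derivative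
      (2 * J t * J1 t + 2 * J1 t * J2 t + n * ((J1 t * J1 t + J t * J2 t) * t - J t * J1 t) / t\<^sup>2)) (at t)"
      unfolding Q_def using that
      by (auto intro!: derivative_eq_intros J J1 simp: power2_eq_square field_simps)
    have P': "((\<lambda>t. t powr n) has_real_derivative (n * t powr n / t)) (at t)"
      using that has_real_derivative_powr[of t n] by (simp add: powr_diff)
    have E': "((\<lambda>t. exp (n / t)) has_real_derivative (- (n / t\<^sup>2) * exp (n / t))) (at t)"
      using that by (auto intro!: derivative_eq_intros simp: power2_eq_square)
    have "(F has_real_derivative
       (n * t powr n / t) * Q t * exp (n / t)
       + t powr n * (2 * J t * J1 t + 2 * J1 t * J2 t + n * ((J1 t * J1 t + J t * J2 t) * t - J t * J1 t) / t\<^sup>2) * exp (n / t)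
       + t powr n * Q t * (- (n / t\<^sup>2) * exp (n / t))) (at t)"
      unfolding F_def
      by (rule DERIV_cong[OF DERIV_mult[OF DERIV_mult[OF P' Q'] E']]) (simp add: algebra_simps)
    also have "(n * t powr n / t) * Q t * exp (n / t)
       + t powr n * (2 * J t * J1 t + 2 * J1 t * J2 t + n * ((J1 t * J1 t + J t * J2 t) * t - J t * J1 t) / t\<^sup>2) * exp (n / t)
       + t powr n * Q t * (- (n / t\<^sup>2) * exp (n / t))
      = t powr n * exp (n / t) * ((n / t) * Q t + (2 * J t * J1 t + 2 * J1 t * J2 t
         + n * ((J1 t * J1 t + J t * J2 t) * t - J t * J1 t) / t\<^sup>2) - (n / t\<^sup>2) * Q t)"
      by (simp add: algebra_simps)
    also have "(n / t) * Q t + (2 * J t * J1 t + 2 * J1 t * J2 t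
         + n * ((J1 t * J1 t + J t * J2 t) * t - J t * J1 t) / t\<^sup>2) - (n / t\<^sup>2) * Q t
      = - (n / t\<^sup>2) * ((J t)\<^sup>2 + (J1 t)\<^sup>2 + (1 + n / t) * (J t * J1 t))"
      unfolding ode[OF that] Q_def using that by (simp add: field_simps power2_eq_square)
    finally show ?thesis .
  qed
  have quad: "a\<^sup>2 + b\<^sup>2 + c * (a * b) \<ge> 0" if "\<bar>c\<bar> \<le> 2" for a b c :: real
  proof -
    have "\<bar>c * (a * b)\<bar> \<le> 2 * \<bar>a * b\<bar>"
      using that by (simp add: abs_mult mult_right_mono)
    moreover have "2 * \<bar>a * b\<bar> \<le> a\<^sup>2 + b\<^sup>2"
      using sum_squares_bound[of "\<bar>a\<bar>" "\<bar>b\<bar>"] by (simp add: abs_mult)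
    ultimately show ?thesis by linarith
  qed
  have "F t \<le> F n"
  proof (rule DERIV_nonpos_imp_nonincreasing[OF t])
    fix s assume s: "n \<le> s" "s \<le> t"
    then have "s > 0" "n / s \<ge> 0" "n / s \<le> 1" using n by auto
    then have "(J s)\<^sup>2 + (J1 s)\<^sup>2 + (1 + n / s) * (J s * J1 s) \<ge> 0" by (intro quad) auto
    then have "s powr n * exp (n / s) * (- (n / s\<^sup>2) * ((J s)\<^sup>2 + (J1 s)\<^sup>2 + (1 + n / s) * (J s * J1 s))) \<le> 0"
      using n by (intro mult_nonneg_nonpos mult_nonpos_nonneg) auto
    then show "\<exists>y. (F has_real_derivative y) (at s) \<and> y \<le> 0"
      using F_deriv[OF \<open>s > 0\<close>] by blast
  qed
  also have "F n \<le> n powr n * 3 * exp 1"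
  proof -
    have "(J n)\<^sup>2 \<le> 1" "(J1 n)\<^sup>2 \<le> 1" using bd by (simp_all add: abs_square_le_1)
    moreover have "J n * J1 n \<le> 1"
      using bd mult_le_one[of "\<bar>J n\<bar>" "\<bar>J1 n\<bar>"] by (simp add: abs_mult[symmetric])
    ultimately have "Q n \<le> 3" using n by (simp add: Q_def)
    then show ?thesis using n by (simp add: F_def)
  qed
  finally have F_le: "F t \<le> n powr n * 3 * exp 1" .
  have tpos: "t > 0" "n / t \<ge> 0" "n / t \<le> 1" using n t by auto
  have "\<bar>2 * (n / t)\<bar> \<le> 2" using tpos by linarith
  then have "(J t)\<^sup>2 + (J1 t)\<^sup>2 + 2 * (n / t) * (J t * J1 t) \<ge> 0" by (rule quad)
  then have "(J t)\<^sup>2 + (J1 t)\<^sup>2 + 2 * (n * (J t * J1 t) / t) \<ge> 0" by (simp add: mult.assoc)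
  moreover have "(J1 t)\<^sup>2 \<ge> 0" by simp
  ultimately have "(J t)\<^sup>2 / 2 \<le> Q t" unfolding Q_def by linarith
  moreover from this have "Q t \<ge> 0" by (rule order_trans[rotated]) simp
  ultimately have "t powr n * ((J t)\<^sup>2 / 2) * 1 \<le> t powr n * Q t * exp (n / t)"
    using tpos by (intro mult_mono) auto
  from order_trans[OF this F_le[unfolded F_def]]
  have "(J t)\<^sup>2 \<le> 6 * exp 1 * n powr n * t powr (- n)"
    using tpos by (simp add: powr_minus field_simps)
  then have "sqrt ((J t)\<^sup>2) \<le> sqrt (6 * exp 1 * n powr n * t powr (- n))"
    by (rule real_sqrt_le_mono)
  also have "\<dots> = sqrt (6 * exp 1 * n powr n) * t powr (- (n / 2))"
    using tpos by (simp add: real_sqrt_mult powr_half_sqrt[symmetric] powr_powr)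
  finally show ?thesis by simp
qed

text \<open>The Fourier transform of the sphere; by symmetry the cosine part is all of it
  (\<open>integral_exp_sphere_uniform\<close>).\<close>
definition sphere_kernel :: "'a::euclidean_space \<Rightarrow> real" where
  "sphere_kernel z = (\<integral>\<omega>. cos (\<omega> \<bullet> z) \<partial>sphere_uniform)"

lemma abs_sphere_integral_le:
  fixes f :: "'a::euclidean_space \<Rightarrow> real"
  assumes [measurable]: "f \<in> borel_measurable borel" and "\<And>\<omega>. norm \<omega> = 1 \<Longrightarrow> \<bar>f \<omega>\<bar> \<le> 1"
  shows "\<bar>\<integral>\<omega>. f \<omega> \<partial>sphere_uniform\<bar> \<le> 1"
proof -
  interpret finite_measure "sphere_uniform :: 'a measure" by (rule finite_measure_sphere_uniform)
  have int: "integrable sphere_uniform f" by (rule integrable_sphere_uniform[where B=1]) (use assms in auto)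
  have "\<bar>\<integral>\<omega>. f \<omega> \<partial>sphere_uniform\<bar> \<le> (\<integral>\<omega>. \<bar>f \<omega>\<bar> \<partial>sphere_uniform)" by (rule integral_abs_bound)
  also have "\<dots> \<le> (\<integral>\<omega>. 1 \<partial>(sphere_uniform :: 'a measure))"
    using AE_sphere_uniform assms(2) by (intro integral_mono_AE integrable_abs int) auto
  finally show ?thesis by (simp add: measure_sphere_uniform_UNIV)
qed

lemma sphere_kernel_radial:
  fixes w z :: "'a::euclidean_space"
  assumes "norm w = norm z"
  shows "sphere_kernel w = sphere_kernel z"
proof -
  obtain T where T: "orthogonal_transformation T" "T w = z" using orthogonal_transformation_between_equal_norms[OF assms] .
  have "sphere_kernel z = (\<integral>\<omega>. cos (T \<omega> \<bullet> z) \<partial>sphere_uniform)"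
    unfolding sphere_kernel_def
    by (rule integral_sphere_uniform_orthogonal[OF T(1), of "\<lambda>\<omega>. cos (\<omega> \<bullet> z)", symmetric]) measurable
  also have "\<dots> = sphere_kernel w"
    using T by (auto simp: sphere_kernel_def orthogonal_transformation_def)
  finally show ?thesis by simp
qed

text \<open>
  Along a ray, the kernel satisfies the equation of \<open>bessel_equation_decay\<close> with
  \<open>n = DIM('a) - 1\<close>: the rotation identities for the \<open>n\<close> coordinate planes that contain the ray add
  up to it, because the squares of the remaining coordinates add up to \<open>1 - \<omega>\<^sub>e\<^sup>2\<close>.
\<close>
lemma sphere_kernel_decay:
  assumes dim: "DIM('a) \<ge> 2"
  obtains C where "C > 0"
    "\<And>z :: 'a::euclidean_space. \<bar>sphere_kernel z\<bar> \<le> C * max 1 (norm z) powr (- ((real DIM('a) - 1) / 2))"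
proof -
  define n where "n = real DIM('a) - 1"
  have n: "n \<ge> 1" using dim by (simp add: n_def)
  obtain e :: 'a where e: "e \<in> Basis" using nonempty_Basis by blast
  note fm = finite_measure_sphere_uniform[where ?'a='a]
  have comp: "\<bar>\<omega> \<bullet> e\<bar> \<le> 1" if "norm \<omega> = 1" for \<omega> :: 'a
    using Basis_le_norm[OF e, of \<omega>] that by auto
  have le1: "\<bar>a * b\<bar> \<le> 1" if "\<bar>a\<bar> \<le> 1" "\<bar>b\<bar> \<le> 1" for a b :: real
    using that by (simp add: abs_mult mult_le_one)
  define J where "J t = (\<integral>\<omega>. cos (t * (\<omega> \<bullet> e)) \<partial>sphere_uniform)" for t
  define J1 where "J1 t = (\<integral>\<omega>. - (\<omega> \<bullet> e) * sin (t * (\<omega> \<bullet> e)) \<partial>sphere_uniform)" for t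
  define J2 where "J2 t = (\<integral>\<omega>. - (\<omega> \<bullet> e)\<^sup>2 * cos (t * (\<omega> \<bullet> e)) \<partial>sphere_uniform)" for t
  have int_sin: "integrable sphere_uniform (\<lambda>\<omega>::'a. - (\<omega> \<bullet> e) * sin (t * (\<omega> \<bullet> e)))" for t
    by (rule integrable_sphere_uniform[where B=1]) (use comp le1 in \<open>auto simp: abs_mult mult_le_one\<close>)
  have int_cos: "integrable sphere_uniform (\<lambda>\<omega>::'a. cos (t * (\<omega> \<bullet> e)))" for t
    by (rule integrable_sphere_uniform[where B=1]) auto
  have int_cos2: "integrable sphere_uniform (\<lambda>\<omega>::'a. (\<omega> \<bullet> j)\<^sup>2 * cos (t * (\<omega> \<bullet> e)))" if "j \<in> Basis" for t j
  proof (rule integrable_sphere_uniform[where B=1])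
    fix \<omega> :: 'a assume "norm \<omega> = 1"
    then have "\<bar>\<omega> \<bullet> j\<bar> \<le> 1" using Basis_le_norm[OF that, of \<omega>] by auto
    then show "norm ((\<omega> \<bullet> j)\<^sup>2 * cos (t * (\<omega> \<bullet> e))) \<le> 1"
      unfolding real_norm_def by (intro le1) (auto simp: abs_square_le_1)
  qed measurable
  have J: "(J has_real_derivative J1 t) (at t)" for t
    unfolding J_def J1_def
  proof (rule has_real_derivative_integral_bounded[OF fm int_cos, where B=1])
    show "((\<lambda>t. cos (t * (\<omega> \<bullet> e))) has_real_derivative - (\<omega> \<bullet> e) * sin (t * (\<omega> \<bullet> e))) (at t)" for t \<omega>
      by (auto intro!: derivative_eq_intros)
    show "AE \<omega> in sphere_uniform. \<forall>t. \<bar>- (\<omega> \<bullet> e) * sin (t * (\<omega> \<bullet> e))\<bar> \<le> 1"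
      using AE_sphere_uniform by eventually_elim (use comp le1 in \<open>auto simp: abs_mult mult_le_one\<close>)
  qed measurable
  have J1: "(J1 has_real_derivative J2 t) (at t)" for t
    unfolding J1_def J2_def
  proof (rule has_real_derivative_integral_bounded[OF fm int_sin, where B=1])
    show "((\<lambda>t. - (\<omega> \<bullet> e) * sin (t * (\<omega> \<bullet> e))) has_real_derivative - (\<omega> \<bullet> e)\<^sup>2 * cos (t * (\<omega> \<bullet> e))) (at t)" for t \<omega>
      by (auto intro!: derivative_eq_intros simp: power2_eq_square)
    show "AE \<omega> in sphere_uniform. \<forall>t. \<bar>- (\<omega> \<bullet> e)\<^sup>2 * cos (t * (\<omega> \<bullet> e))\<bar> \<le> 1"
      using AE_sphere_uniform
    proof eventually_elim
      case (elim \<omega>)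
      then have "\<bar>- (\<omega> \<bullet> e)\<^sup>2\<bar> \<le> 1" using comp by (simp add: abs_square_le_1)
      then show ?case by (intro allI le1) auto
    qed
  qed measurable
  have ode: "J2 t = - J t - n / t * J1 t" if "t > 0" for t
  proof -
    let ?s = "\<lambda>\<omega>::'a. (\<omega> \<bullet> e) * sin (t * (\<omega> \<bullet> e))" and ?c = "\<lambda>\<omega>::'a. cos (t * (\<omega> \<bullet> e))"
    have s: "integrable sphere_uniform ?s" and J1': "J1 t = - (\<integral>\<omega>. ?s \<omega> \<partial>sphere_uniform)"
      using int_sin[of t] by (simp_all add: J1_def)
    have "(\<integral>\<omega>. ?s \<omega> \<partial>sphere_uniform) - t * (\<integral>\<omega>. (\<omega> \<bullet> j)\<^sup>2 * ?c \<omega> \<partial>sphere_uniform) = 0"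
      if "j \<in> Basis - {e}" for j
    proof -
      have "j \<in> Basis" "e \<noteq> j" using that by auto
      then show ?thesis
        using sphere_rotation_identity[OF e, of j t] s int_cos2[of j t]
        by (simp add: mult.assoc)
    qed
    then have "(\<Sum>j\<in>Basis - {e}. (\<integral>\<omega>. ?s \<omega> \<partial>sphere_uniform) - t * (\<integral>\<omega>. (\<omega> \<bullet> j)\<^sup>2 * ?c \<omega> \<partial>sphere_uniform)) = 0"
      by simp
    moreover have "real (card (Basis - {e})) = n" using e dim by (simp add: n_def of_nat_diff)
    ultimately have "n * (\<integral>\<omega>. ?s \<omega> \<partial>sphere_uniform)
        = t * (\<Sum>j\<in>Basis - {e}. \<integral>\<omega>. (\<omega> \<bullet> j)\<^sup>2 * ?c \<omega> \<partial>sphere_uniform)"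
      by (simp add: sum_subtractf sum_distrib_left)
    also have "(\<Sum>j\<in>Basis - {e}. \<integral>\<omega>. (\<omega> \<bullet> j)\<^sup>2 * ?c \<omega> \<partial>sphere_uniform)
        = (\<integral>\<omega>. (\<Sum>j\<in>Basis - {e}. (\<omega> \<bullet> j)\<^sup>2 * ?c \<omega>) \<partial>sphere_uniform)"
      by (rule Bochner_Integration.integral_sum[symmetric]) (use int_cos2 in auto)
    also have "\<dots> = (\<integral>\<omega>. ?c \<omega> - (\<omega> \<bullet> e)\<^sup>2 * ?c \<omega> \<partial>sphere_uniform)"
    proof (rule integral_cong_AE)
      show "AE \<omega> in sphere_uniform. (\<Sum>j\<in>Basis - {e}. (\<omega> \<bullet> j)\<^sup>2 * ?c \<omega>) = ?c \<omega> - (\<omega> \<bullet> e)\<^sup>2 * ?c \<omega>"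
        using AE_sphere_uniform
      proof eventually_elim
        case (elim \<omega>)
        have "1 = \<omega> \<bullet> \<omega>" using elim by (simp add: norm_eq_1)
        also have "\<dots> = (\<Sum>j\<in>Basis. (\<omega> \<bullet> j)\<^sup>2)" by (subst euclidean_inner) (simp add: power2_eq_square)
        also have "\<dots> = (\<omega> \<bullet> e)\<^sup>2 + (\<Sum>j\<in>Basis - {e}. (\<omega> \<bullet> j)\<^sup>2)" using e by (subst sum.remove[of _ e]) auto
        finally have "(\<Sum>j\<in>Basis - {e}. (\<omega> \<bullet> j)\<^sup>2) = 1 - (\<omega> \<bullet> e)\<^sup>2" by simp
        then show ?case by (simp add: sum_distrib_right[symmetric] left_diff_distrib)
      qed
    qed measurable
    also have "\<dots> = J t + J2 t"
      using int_cos[of t] int_cos2[OF e, of t] by (simp add: J_def J2_def)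
    finally show ?thesis using that by (simp add: J1' field_simps)
  qed
  have "\<bar>J n\<bar> \<le> 1" unfolding J_def by (rule abs_sphere_integral_le) auto
  moreover have "\<bar>J1 n\<bar> \<le> 1"
    unfolding J1_def by (rule abs_sphere_integral_le) (use comp le1 in \<open>auto simp: abs_mult mult_le_one\<close>)
  ultimately have large: "\<bar>J t\<bar> \<le> sqrt (6 * exp 1 * n powr n) * t powr (- (n / 2))" if "t \<ge> n" for t
    using bessel_equation_decay[OF n J J1 ode _ _ that] by blast
  have kernel: "sphere_kernel z = J (norm z)" for z :: 'a
  proof -
    have "sphere_kernel z = sphere_kernel (norm z *\<^sub>R e)" using e by (intro sphere_kernel_radial) simp
    then show ?thesis by (simp add: sphere_kernel_def J_def)
  qed
  \<comment> \<open>The factor \<open>n powr (n / 2)\<close> in \<open>C\<close> makes the bound trivial for \<open>norm z < n\<close>, where the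
    energy estimate is not available.\<close>
  define C where "C = sqrt (6 * exp 1 * n powr n)"
  have C_ge: "C \<ge> n powr (n / 2)"
  proof -
    have "(1::real) \<le> 6 * exp 1" using exp_ge_add_one_self[of 1] by linarith
    then have "1 * n powr n \<le> 6 * exp 1 * n powr n" by (intro mult_right_mono) auto
    then have "sqrt (n powr n) \<le> C" unfolding C_def by simp
    moreover have "sqrt (n powr n) = n powr (n / 2)" using n by (simp add: powr_half_sqrt[symmetric] powr_powr)
    ultimately show ?thesis by simp
  qed
  have "C > 0" using C_ge n by (smt (verit) powr_gt_zero)
  moreover have "\<bar>sphere_kernel z\<bar> \<le> C * max 1 (norm z) powr (- (n / 2))" for z :: 'a
  proof (cases "norm z \<ge> n")
    case True
    then show ?thesis using large[OF True] n by (simp add: kernel C_def max_def)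
  next
    case False
    have "\<bar>sphere_kernel z\<bar> \<le> 1" unfolding sphere_kernel_def by (rule abs_sphere_integral_le) auto
    also have "1 = n powr (n / 2) * n powr (- (n / 2))" using n by (simp add: powr_minus)
    also have "\<dots> \<le> C * max 1 (norm z) powr (- (n / 2))"
      using False n C_ge by (intro mult_mono powr_mono2') (auto simp: C_def)
    finally show ?thesis .
  qed
  ultimately show ?thesis using that unfolding n_def by blast
qed

section \<open>Averaging the Fourier transform of a block-symmetric function\<close>
lemma orthogonal_transformation_map_prod:
  fixes A :: "'a::euclidean_space \<Rightarrow> 'a" and B :: "'b::euclidean_space \<Rightarrow> 'b"
  assumes "orthogonal_transformation A" "orthogonal_transformation B"
  shows "orthogonal_transformation (map_prod A B)"
proof -
  have "linear A" "linear B" using assms by (auto dest: orthogonal_transformation_linear)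
  then have "linear (map_prod A B)"
    by (intro linearI) (auto simp: linear_add linear_cmul)
  then show ?thesis
    using assms by (auto simp: orthogonal_transformation_def)
qed

lemma fourier_block_orthogonal:
  fixes f :: "'a::euclidean_space \<times> 'b::euclidean_space \<Rightarrow> complex"
  assumes [measurable]: "f \<in> borel_measurable borel" and sym: "block_symmetric f"
    and "orthogonal_transformation A" "orthogonal_transformation B"
  shows "fourier f (A \<xi>, B \<eta>) = fourier f (\<xi>, \<eta>)"
proof -
  define T where "T = map_prod A B"
  have T: "orthogonal_transformation T"
    unfolding T_def using assms by (intro orthogonal_transformation_map_prod)
  note [measurable] = orthogonal_transformation_borel[OF T]
  have fT: "f (T x) = f x" for x
    using sym assms(3,4) unfolding block_symmetric_def block_orthogonal_group_def T_def
    by (metis (mono_tags, lifting) comp_apply mem_Collect_eq)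
  have "fourier f (T (\<xi>, \<eta>)) = (\<integral>x. f x * exp (- \<i> * complex_of_real (T (\<xi>, \<eta>) \<bullet> x)) \<partial>distr lborel borel T)"
    by (simp add: fourier_def distr_lborel_orthogonal_transformation[OF T])
  also have "\<dots> = (\<integral>x. f (T x) * exp (- \<i> * complex_of_real (T (\<xi>, \<eta>) \<bullet> T x)) \<partial>lborel)"
    by (rule integral_distr) auto
  also have "\<dots> = fourier f (\<xi>, \<eta>)"
    using T unfolding fourier_def fT orthogonal_transformation_def by metis
  finally show ?thesis by (simp add: T_def)
qed

lemma integral_exp_sphere_uniform:
  "(\<integral>\<omega>. exp (- \<i> * complex_of_real (\<omega> \<bullet> z)) \<partial>sphere_uniform) = complex_of_real (sphere_kernel z)"
proof -
  have "orthogonal_transformation (\<lambda>x::'a. - x)"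
    by (simp add: orthogonal_transformation linear_iff)
  from integral_sphere_uniform_orthogonal[OF this, of "\<lambda>\<omega>. sin (\<omega> \<bullet> z)"]
  have "(\<integral>\<omega>. - sin (\<omega> \<bullet> z) \<partial>sphere_uniform) = (\<integral>\<omega>. sin (\<omega> \<bullet> z) \<partial>sphere_uniform)"
    by simp
  then have sin0: "(\<integral>\<omega>. sin (\<omega> \<bullet> z) \<partial>sphere_uniform) = 0" by simp
  have int: "integrable sphere_uniform (\<lambda>\<omega>. cos (\<omega> \<bullet> z))" "integrable sphere_uniform (\<lambda>\<omega>. sin (\<omega> \<bullet> z))"
    by (rule integrable_sphere_uniform[where B=1]; simp)+
  have "(\<integral>\<omega>. exp (- \<i> * complex_of_real (\<omega> \<bullet> z)) \<partial>sphere_uniform)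
      = (\<integral>\<omega>. complex_of_real (cos (\<omega> \<bullet> z)) - \<i> * complex_of_real (sin (\<omega> \<bullet> z)) \<partial>sphere_uniform)"
    by (intro Bochner_Integration.integral_cong refl) (simp add: complex_eq_iff Re_exp Im_exp)
  also have "\<dots> = complex_of_real (\<integral>\<omega>. cos (\<omega> \<bullet> z) \<partial>sphere_uniform)
      - \<i> * complex_of_real (\<integral>\<omega>. sin (\<omega> \<bullet> z) \<partial>sphere_uniform)"
    using int by (subst Bochner_Integration.integral_diff) auto
  finally show ?thesis by (simp add: sin0 sphere_kernel_def)
qed

lemma sphere_kernel_borel [measurable]: "sphere_kernel \<in> borel_measurable borel"
proof -
  interpret finite_measure "sphere_uniform :: 'a measure" by (rule finite_measure_sphere_uniform)
  show ?thesis unfolding sphere_kernel_def[abs_def] by measurable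
qed

text \<open>
  The transform takes the same value at \<open>(\<xi>, \<eta>)\<close> and at every \<open>(|\<xi>| \<omega>, |\<eta>| \<omega>')\<close> with unit
  vectors \<open>\<omega>\<close>, \<open>\<omega>'\<close>. Averaging over these and exchanging the integrals averages the exponential.
\<close>
lemma fourier_block_average:
  fixes f :: "'a::euclidean_space \<times> 'b::euclidean_space \<Rightarrow> complex"
  assumes f: "integrable lborel f" and sym: "block_symmetric f"
  shows "fourier f (\<xi>, \<eta>) =
    (\<integral>z. f z * complex_of_real (sphere_kernel (norm \<xi> *\<^sub>R fst z) * sphere_kernel (norm \<eta> *\<^sub>R snd z)) \<partial>lborel)"
proof -
  have f_meas [measurable]: "f \<in> borel_measurable borel" using f by auto
  interpret a: finite_measure "sphere_uniform :: 'a measure" by (rule finite_measure_sphere_uniform)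
  interpret b: finite_measure "sphere_uniform :: 'b measure" by (rule finite_measure_sphere_uniform)
  interpret ab: pair_sigma_finite "sphere_uniform :: 'a measure" "sphere_uniform :: 'b measure" ..
  define P where "P = (sphere_uniform :: 'a measure) \<Otimes>\<^sub>M (sphere_uniform :: 'b measure)"
  have P_sets [measurable_cong]: "sets P = sets (borel \<Otimes>\<^sub>M borel)" and P_space: "space P = UNIV"
    unfolding P_def by (auto intro!: sets_pair_measure_cong simp: space_pair_measure)
  have P1: "emeasure P UNIV = 1"
    using b.emeasure_pair_measure_Times[of UNIV sphere_uniform UNIV]
    by (simp add: P_def emeasure_sphere_uniform_UNIV)
  interpret P: finite_measure P by (rule finite_measureI) (simp add: P1 P_space)
  interpret Pl: pair_sigma_finite P "lborel :: ('a \<times> 'b) measure" ..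
  define c where "c p = (norm \<xi> *\<^sub>R fst p, norm \<eta> *\<^sub>R snd p)" for p :: "'a \<times> 'b"
  have c_meas [measurable]: "c \<in> borel_measurable P"
    unfolding c_def borel_prod[symmetric] by measurable
  define h where "h p z = f z * exp (- \<i> * complex_of_real (c p \<bullet> z))" for p z
  have h_norm: "norm (h p z) = cmod (f z)" for p z by (simp add: h_def norm_mult)
  have AE_P: "AE p in P. norm (fst p) = 1 \<and> norm (snd p) = 1"
    unfolding P_def
  proof (rule ab.AE_pair_measure)
    show "AE x in sphere_uniform. AE y in sphere_uniform. norm (fst (x :: 'a, y :: 'b)) = 1 \<and> norm (snd (x, y)) = 1"
      using AE_sphere_uniform
    proof eventually_elim
      case (elim x)
      show ?case using AE_sphere_uniform by eventually_elim (simp add: elim)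
    qed
  qed measurable
  have "fourier f (\<xi>, \<eta>) = (\<integral>p. fourier f (\<xi>, \<eta>) \<partial>P)"
    by (simp add: P_space measure_def P1)
  also have "\<dots> = (\<integral>p. \<integral>z. h p z \<partial>lborel \<partial>P)"
  proof (rule integral_cong_AE)
    show "(\<lambda>p. \<integral>z. h p z \<partial>lborel) \<in> borel_measurable P" unfolding h_def by measurable
    show "AE p in P. fourier f (\<xi>, \<eta>) = (\<integral>z. h p z \<partial>lborel)"
      using AE_P
    proof eventually_elim
      case (elim p)
      obtain A where A: "orthogonal_transformation A" "A \<xi> = norm \<xi> *\<^sub>R fst p"
        using orthogonal_transformation_between_equal_norms[of \<xi> "norm \<xi> *\<^sub>R fst p"] elim by auto
      obtain B where B: "orthogonal_transformation B" "B \<eta> = norm \<eta> *\<^sub>R snd p"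
        using orthogonal_transformation_between_equal_norms[of \<eta> "norm \<eta> *\<^sub>R snd p"] elim by auto
      have "fourier f (\<xi>, \<eta>) = fourier f (c p)"
        using fourier_block_orthogonal[OF f_meas sym A(1) B(1), of \<xi> \<eta>] by (simp add: A B c_def)
      then show ?case by (simp add: h_def fourier_def)
    qed
  qed simp
  also have "\<dots> = (\<integral>z. \<integral>p. h p z \<partial>P \<partial>lborel)"
  proof (rule Pl.Fubini_integral[symmetric], rule Pl.Fubini_integrable)
    show "case_prod h \<in> borel_measurable (P \<Otimes>\<^sub>M lborel)" unfolding h_def by measurable
    show "integrable P (\<lambda>x. \<integral>y. norm (case (x, y) of (x, xa) \<Rightarrow> h x xa) \<partial>lborel)"
      by (simp add: h_norm)
    have "h p \<in> borel_measurable lborel" for p unfolding h_def[abs_def] by measurable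
    then have "integrable lborel (h p)" for p
      by (intro Bochner_Integration.integrable_bound[OF f]) (auto simp: h_norm)
    then show "AE x in P. integrable lborel (\<lambda>y. case (x, y) of (x, xa) \<Rightarrow> h x xa)" by simp
  qed
  also have "\<dots> = (\<integral>z. f z * complex_of_real (sphere_kernel (norm \<xi> *\<^sub>R fst z) * sphere_kernel (norm \<eta> *\<^sub>R snd z)) \<partial>lborel)"
  proof (rule Bochner_Integration.integral_cong[OF refl])
    fix z :: "'a \<times> 'b"
    let ?E = "\<lambda>p. exp (- \<i> * complex_of_real (fst p \<bullet> (norm \<xi> *\<^sub>R fst z))) * exp (- \<i> * complex_of_real (snd p \<bullet> (norm \<eta> *\<^sub>R snd z)))"
    have E: "exp (- \<i> * complex_of_real (c p \<bullet> z)) = ?E p" for p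
      by (cases z) (simp add: c_def exp_add[symmetric] algebra_simps)
    have "integrable P ?E"
      by (rule P.integrable_const_bound[where B=1]) (auto simp: norm_mult)
    then have "(\<integral>p. ?E p \<partial>P) = (\<integral>x. \<integral>y. ?E (x, y) \<partial>sphere_uniform \<partial>sphere_uniform)"
      unfolding P_def by (rule ab.integral_fst'[symmetric])
    also have "\<dots> = complex_of_real (sphere_kernel (norm \<xi> *\<^sub>R fst z) * sphere_kernel (norm \<eta> *\<^sub>R snd z))"
      by (simp only: fst_conv snd_conv integral_mult_right_zero integral_mult_left_zero
          integral_exp_sphere_uniform of_real_mult)
    finally show "(\<integral>p. h p z \<partial>P) = f z * complex_of_real (sphere_kernel (norm \<xi> *\<^sub>R fst z) * sphere_kernel (norm \<eta> *\<^sub>R snd z))"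
      by (simp only: h_def E integral_mult_right_zero)
  qed
  finally show ?thesis .
qed

text \<open>
  The majorant of \<open>sphere_kernel\<close> up to a constant. The maximum also gives the value \<open>1\<close> at the
  origin, where a bare negative power would be \<open>0\<close>.
\<close>
definition decay :: "'a::euclidean_space \<Rightarrow> real" where
  "decay z = max 1 (norm z) powr (- ((real DIM('a) - 1) / 2))"

lemma decay_borel [measurable]: "decay \<in> borel_measurable borel"
  unfolding decay_def[abs_def] by measurable

lemma decay_pos: "decay z > 0"
  by (auto simp: decay_def powr_gt_zero)

lemma fourier_block_bound:
  assumes "DIM('a::euclidean_space) \<ge> 2" "DIM('b::euclidean_space) \<ge> 2"
  obtains C where "C > 0"
    "\<And>(f :: 'a \<times> 'b \<Rightarrow> complex) \<xi> \<eta>. integrable lborel f \<Longrightarrow> block_symmetric f \<Longrightarrow>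
      ennreal (cmod (fourier f (\<xi>, \<eta>))) \<le> ennreal C *
        (\<integral>\<^sup>+ z. ennreal (cmod (f z)) * (ennreal (decay (norm \<xi> *\<^sub>R fst z)) * ennreal (decay (norm \<eta> *\<^sub>R snd z))) \<partial>lborel)"
proof -
  obtain C1 where C1: "C1 > 0" "\<And>z :: 'a. \<bar>sphere_kernel z\<bar> \<le> C1 * decay z"
    using sphere_kernel_decay[OF assms(1)] unfolding decay_def by blast
  obtain C2 where C2: "C2 > 0" "\<And>z :: 'b. \<bar>sphere_kernel z\<bar> \<le> C2 * decay z"
    using sphere_kernel_decay[OF assms(2)] unfolding decay_def by blast
  show ?thesis
  proof (rule that[of "C1 * C2"])
    show "C1 * C2 > 0" using C1 C2 by simp
    fix f :: "'a \<times> 'b \<Rightarrow> complex" and \<xi> :: 'a and \<eta> :: 'b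
    assume f: "integrable lborel f" and sym: "block_symmetric f"
    then have [measurable]: "f \<in> borel_measurable borel" by auto
    have [measurable]: "(\<lambda>z. decay (norm \<xi> *\<^sub>R fst z)) \<in> borel_measurable (borel :: ('a \<times> 'b) measure)"
      "(\<lambda>z. decay (norm \<eta> *\<^sub>R snd z)) \<in> borel_measurable (borel :: ('a \<times> 'b) measure)"
      unfolding borel_prod[symmetric] by measurable
    let ?K = "\<lambda>z. sphere_kernel (norm \<xi> *\<^sub>R fst z) * sphere_kernel (norm \<eta> *\<^sub>R snd z)"
    let ?D = "\<lambda>z. decay (norm \<xi> *\<^sub>R fst z) * decay (norm \<eta> *\<^sub>R snd z)"
    have K: "\<bar>?K z\<bar> \<le> C1 * C2 * ?D z" for z :: "'a \<times> 'b"
    proof -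
      have "\<bar>?K z\<bar> \<le> (C1 * decay (norm \<xi> *\<^sub>R fst z)) * (C2 * decay (norm \<eta> *\<^sub>R snd z))"
        unfolding abs_mult using C1 C2 decay_pos[of "norm \<xi> *\<^sub>R fst z"] by (intro mult_mono) auto
      then show ?thesis by (simp add: algebra_simps)
    qed
    have "ennreal (cmod (fourier f (\<xi>, \<eta>))) \<le> (\<integral>\<^sup>+ z. ennreal (cmod (f z * complex_of_real (?K z))) \<partial>lborel)"
      unfolding fourier_block_average[OF f sym]
      by (cases "integrable lborel (\<lambda>z. f z * complex_of_real (?K z))")
         (auto intro: integral_norm_bound_ennreal simp: not_integrable_integral_eq)
    also have "\<dots> \<le> (\<integral>\<^sup>+ z. ennreal (C1 * C2) * (ennreal (cmod (f z)) * (ennreal (decay (norm \<xi> *\<^sub>R fst z)) * ennreal (decay (norm \<eta> *\<^sub>R snd z)))) \<partial>lborel)"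
    proof (rule nn_integral_mono)
      fix z
      have "cmod (f z * complex_of_real (?K z)) \<le> cmod (f z) * (C1 * C2 * ?D z)"
        unfolding norm_mult norm_of_real by (intro mult_left_mono K) auto
      then show "ennreal (cmod (f z * complex_of_real (?K z))) \<le>
        ennreal (C1 * C2) * (ennreal (cmod (f z)) * (ennreal (decay (norm \<xi> *\<^sub>R fst z)) * ennreal (decay (norm \<eta> *\<^sub>R snd z))))"
        using C1 C2 decay_pos[of "norm \<xi> *\<^sub>R fst z"] decay_pos[of "norm \<eta> *\<^sub>R snd z"]
        by (simp add: ennreal_mult[symmetric] less_imp_le ennreal_leI algebra_simps)
    qed
    also have "\<dots> = ennreal (C1 * C2) * (\<integral>\<^sup>+ z. ennreal (cmod (f z)) * (ennreal (decay (norm \<xi> *\<^sub>R fst z)) * ennreal (decay (norm \<eta> *\<^sub>R snd z))) \<partial>lborel)"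
      by (rule nn_integral_cmult) measurable
    finally show "ennreal (cmod (fourier f (\<xi>, \<eta>))) \<le> \<dots>" .
  qed
qed

section \<open>Duality of Lorentz and weak Lebesgue spaces\<close>
lemma emeasure_subgraph: "emeasure lborel {t. 0 < t \<and> ennreal t < c} = c"
proof (cases c)
  case (real r)
  then have "{t. 0 < t \<and> ennreal t < c} = {0<..<r}" by (auto simp: ennreal_less_iff)
  then show ?thesis using real by simp
next
  case top
  then have "{t. 0 < t \<and> ennreal t < c} = {0<..}" by auto
  moreover have "emeasure lborel {0::real<..} = \<infinity>"
  proof (rule ccontr)
    assume fin: "emeasure lborel {0::real<..} \<noteq> \<infinity>"
    obtain r where r: "emeasure lborel {0::real<..} = ennreal r" "r \<ge> 0" using fin by (cases "emeasure lborel {0::real<..}") auto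
    have "emeasure lborel {0::real<..<r + 1} \<le> emeasure lborel {0::real<..}" by (intro emeasure_mono) auto
    then show False using r by (simp add: ennreal_le_iff)
  qed
  ultimately show ?thesis using top by simp
qed

lemma layer_cake:
  fixes g h :: "'a \<Rightarrow> ennreal"
  assumes "sigma_finite_measure M" and [measurable]: "g \<in> borel_measurable M" "h \<in> borel_measurable M"
  shows "(\<integral>\<^sup>+ x. g x * h x \<partial>M) =
    (\<integral>\<^sup>+ t\<in>{0<..}. (\<integral>\<^sup>+ x. h x * indicator {x \<in> space M. ennreal t < g x} x \<partial>M) \<partial>lborel)"
proof -
  interpret sigma_finite_measure M by fact
  interpret P: pair_sigma_finite M "lborel :: real measure" ..
  have "(\<integral>\<^sup>+ x. g x * h x \<partial>M) = (\<integral>\<^sup>+ x. \<integral>\<^sup>+ t. h x * indicator {t. 0 < t \<and> ennreal t < g x} t \<partial>lborel \<partial>M)"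
    by (intro nn_integral_cong, subst nn_integral_cmult) (auto simp: emeasure_subgraph mult.commute)
  also have "\<dots> = (\<integral>\<^sup>+ t. \<integral>\<^sup>+ x. h x * indicator {t. 0 < t \<and> ennreal t < g x} t \<partial>M \<partial>lborel)"
    by (subst P.Fubini') (auto simp: indicator_def[abs_def])
  also have "\<dots> = (\<integral>\<^sup>+ t\<in>{0<..}. (\<integral>\<^sup>+ x. h x * indicator {x \<in> space M. ennreal t < g x} x \<partial>M) \<partial>lborel)"
  proof (rule nn_integral_cong)
    fix t :: real
    show "(\<integral>\<^sup>+ x. h x * indicator {t. 0 < t \<and> ennreal t < g x} t \<partial>M) =
       (\<integral>\<^sup>+ x. h x * indicator {x \<in> space M. ennreal t < g x} x \<partial>M) * indicator {0<..} t"
      by (cases "0 < t") (auto intro!: nn_integral_cong split: split_indicator)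
  qed
  finally show ?thesis .
qed

text \<open>
  Membership in \<open>L\<^bsup>q,\<infinity>\<^esup>\<close> with quasi-norm at most \<open>B\<^bsup>1/q\<^esup>\<close>. The bound is put on the distribution
  function because bounds of this form can be integrated over a further variable.
\<close>
definition weak_type :: "'a measure \<Rightarrow> real \<Rightarrow> real \<Rightarrow> ('a \<Rightarrow> ennreal) \<Rightarrow> bool" where
  "weak_type M q B h \<longleftrightarrow> (\<forall>s>0. distribution_function M h s \<le> ennreal (B * s powr - q))"

lemma nn_integral_powr_tail:
  fixes T q :: real
  assumes "T > 0" "q > 1"
  shows "(\<integral>\<^sup>+ s\<in>{T..}. ennreal (s powr - q) \<partial>lborel) = ennreal (T powr (1 - q) / (q - 1))"
proof -
  have "((\<lambda>s. s powr - q) has_integral T powr (1 - q) / (q - 1)) {T..}"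
    using has_integral_powr_to_inf[of "- q" T] assms by (simp add: minus_divide_right)
  then have "((\<lambda>s. if s \<in> {T..} then s powr - q else 0) has_integral T powr (1 - q) / (q - 1)) UNIV"
    by (simp only: has_integral_restrict_UNIV)
  then have "(\<integral>\<^sup>+ s. ennreal (if s \<in> {T..} then s powr - q else 0) \<partial>lborel) = ennreal (T powr (1 - q) / (q - 1))"
    by (intro nn_integral_has_integral_lborel) auto
  moreover have "(\<integral>\<^sup>+ s\<in>{T..}. ennreal (s powr - q) \<partial>lborel)
      = (\<integral>\<^sup>+ s. ennreal (if s \<in> {T..} then s powr - q else 0) \<partial>lborel)"
    by (intro nn_integral_cong) (auto split: split_indicator)
  ultimately show ?thesis by simp
qed

lemma nn_integral_powr_near_0:
  fixes b :: real
  assumes "b < 1"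
  shows "(\<integral>\<^sup>+ s\<in>{0..1}. ennreal (s powr - b) \<partial>lborel) = ennreal (1 / (1 - b))"
proof -
  have "((\<lambda>s. s powr - b) has_integral 1 / (1 - b)) {0..1}"
    using has_integral_powr_from_0[of "- b" 1] assms by simp
  then have "((\<lambda>s. if s \<in> {0..1} then s powr - b else 0) has_integral 1 / (1 - b)) UNIV"
    by (simp only: has_integral_restrict_UNIV)
  then have "(\<integral>\<^sup>+ s. ennreal (if s \<in> {0..1} then s powr - b else 0) \<partial>lborel) = ennreal (1 / (1 - b))"
    by (intro nn_integral_has_integral_lborel) auto
  moreover have "(\<integral>\<^sup>+ s\<in>{0..1}. ennreal (s powr - b) \<partial>lborel)
      = (\<integral>\<^sup>+ s. ennreal (if s \<in> {0..1} then s powr - b else 0) \<partial>lborel)"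
    by (intro nn_integral_cong) (auto split: split_indicator)
  ultimately show ?thesis by simp
qed

text \<open>
  The dual description of weak \<open>L\<^sup>q\<close>: among sets \<open>E\<close> of measure \<open>v\<close> the integral is of order
  \<open>v\<^bsup>1-1/q\<^esup>\<close>. By the layer-cake formula one integrates over the height \<open>s\<close> the smaller of \<open>v\<close> and
  \<open>B s\<^bsup>-q\<^esup>\<close>.
\<close>
lemma weak_type_integral_on_set:
  assumes sf: "sigma_finite_measure M" and h [measurable]: "h \<in> borel_measurable M"
    and weak: "weak_type M q B h" and q: "q > 1" and B: "B > 0" and E [measurable]: "E \<in> sets M"
    and v: "emeasure M E = ennreal v" "v \<ge> 0"
  shows "(\<integral>\<^sup>+ x. h x * indicator E x \<partial>M) \<le> ennreal (q / (q - 1) * B powr (1 / q) * v powr (1 - 1 / q))"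
proof (cases "v = 0")
  case True
  then have "AE x in M. x \<notin> E" using v by (intro AE_not_in) auto
  then have "(\<integral>\<^sup>+ x. h x * indicator E x \<partial>M) = 0"
    by (subst nn_integral_0_iff_AE) (auto elim: eventually_mono)
  then show ?thesis by simp
next
  case False
  then have v0: "v > 0" using v by simp
  \<comment> \<open>The height at which the two bounds \<open>v\<close> and \<open>B s powr - q\<close> coincide.\<close>
  define T where "T = B powr (1 / q) * v powr (- (1 / q))"
  have T: "T > 0" using B v0 by (simp add: T_def)
  have "(\<integral>\<^sup>+ x. h x * indicator E x \<partial>M) =
      (\<integral>\<^sup>+ s\<in>{0<..}. (\<integral>\<^sup>+ x. indicator E x * indicator {x \<in> space M. ennreal s < h x} x \<partial>M) \<partial>lborel)"
    by (rule layer_cake[OF sf]) auto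
  also have "\<dots> \<le> (\<integral>\<^sup>+ s. ennreal v * indicator {0..T} s + ennreal B * (ennreal (s powr - q) * indicator {T..} s) \<partial>lborel)"
  proof (rule nn_integral_mono)
    fix s :: real
    let ?F = "{x \<in> space M. ennreal s < h x}"
    have eq: "(\<integral>\<^sup>+ x. indicator E x * indicator ?F x \<partial>M) = emeasure M (E \<inter> ?F)"
      by (simp add: indicator_inter_arith[symmetric])
    have 1: "emeasure M (E \<inter> ?F) \<le> ennreal v" unfolding v(1)[symmetric] by (intro emeasure_mono) auto
    have 2: "emeasure M (E \<inter> ?F) \<le> ennreal (B * s powr - q)" if "s > 0"
    proof -
      have "emeasure M (E \<inter> ?F) \<le> emeasure M ?F" by (intro emeasure_mono) auto
      also have "\<dots> \<le> ennreal (B * s powr - q)"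
        using weak that by (auto simp: weak_type_def distribution_function_def)
      finally show ?thesis .
    qed
    show "(\<integral>\<^sup>+ x. indicator E x * indicator ?F x \<partial>M) * indicator {0<..} s
      \<le> ennreal v * indicator {0..T} s + ennreal B * (ennreal (s powr - q) * indicator {T..} s)"
    proof (cases "s \<le> T")
      case True
      then show ?thesis using 1 by (auto simp: eq split: split_indicator intro: add_increasing2)
    next
      case False
      then show ?thesis using 2 T B by (auto simp: eq ennreal_mult split: split_indicator)
    qed
  qed
  also have "\<dots> = ennreal v * ennreal T + ennreal B * ennreal (T powr (1 - q) / (q - 1))"
    using T q by (subst nn_integral_add) (auto simp: nn_integral_cmult nn_integral_powr_tail)
  also have "\<dots> = ennreal (v * T + B * (T powr (1 - q) / (q - 1)))"
    using T B v0 q by (simp add: ennreal_mult[symmetric] ennreal_plus[symmetric] del: ennreal_plus)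
  also have "v * T + B * (T powr (1 - q) / (q - 1)) = q / (q - 1) * B powr (1 / q) * v powr (1 - 1 / q)"
  proof -
    have "v powr (1 - 1 / q) = v * v powr (- (1 / q))"
      using v0 powr_add[of v 1 "- (1 / q)"] by simp
    then have 1: "v * T = B powr (1 / q) * v powr (1 - 1 / q)"
      by (simp only: T_def mult_ac)
    have e: "1 / q * (1 - q) = 1 / q - 1" "- (1 / q) * (1 - q) = 1 - 1 / q" using q by (simp_all add: field_simps)
    have "T powr (1 - q) = B powr (1 / q - 1) * v powr (1 - 1 / q)"
      unfolding T_def using B v0 by (simp only: powr_mult powr_powr e powr_ge_zero)
    moreover have "B * B powr (1 / q - 1) = B powr (1 / q)" using B powr_add[of B 1 "1 / q - 1"] by simp
    ultimately have "B * T powr (1 - q) = B powr (1 / q) * v powr (1 - 1 / q)"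
      by (simp only: mult.assoc[symmetric])
    then have "v * T + B * (T powr (1 - q) / (q - 1)) = B powr (1 / q) * v powr (1 - 1 / q) * (1 + 1 / (q - 1))"
      using 1 by (simp add: distrib_left)
    also have "1 + 1 / (q - 1) = q / (q - 1)" using q by (simp add: field_simps)
    finally show ?thesis by (simp only: mult_ac)
  qed
  finally show ?thesis .
qed

text \<open>For \<open>s = 1\<close> the factors \<open>t\<close> and \<open>1/t\<close> in the definition of the quasi-norm cancel.\<close>
lemma lorentz_norm_1:
  assumes "p > 0"
  shows "lorentz_norm M p 1 g = ennreal p * (\<integral>\<^sup>+ t\<in>{0<..}. epowr (distribution_function M g t) (1 / p) \<partial>lborel)"
proof -
  have [simp]: "epowr x 1 = x" for x by (cases x) (auto simp: epowr_def)
  have *: "ennreal t * e * ennreal (1 / t) = e" if "t > 0" for t e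
    using that by (simp add: mult.commute[of "ennreal t"] mult.assoc ennreal_mult[symmetric])
  have "lorentz_norm M p 1 g = ennreal p * (\<integral>\<^sup>+ t. (ennreal t * epowr (distribution_function M g t) (1 / p) * ennreal (1 / t)) * indicator {0<..} t \<partial>lborel)"
    using assms by (simp add: lorentz_norm_def)
  also have "(\<integral>\<^sup>+ t. (ennreal t * epowr (distribution_function M g t) (1 / p) * ennreal (1 / t)) * indicator {0<..} t \<partial>lborel)
    = (\<integral>\<^sup>+ t\<in>{0<..}. epowr (distribution_function M g t) (1 / p) \<partial>lborel)"
    by (intro nn_integral_cong) (auto split: split_indicator simp: *)
  finally show ?thesis .
qed

lemma epowr_borel [measurable]: "(\<lambda>x. epowr x a) \<in> borel_measurable borel"
  unfolding epowr_def[abs_def] by measurable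

lemma distribution_function_borel:
  assumes "sigma_finite_measure M" and [measurable]: "g \<in> borel_measurable M"
  shows "distribution_function M g \<in> borel_measurable borel"
proof -
  interpret sigma_finite_measure M by fact
  show ?thesis unfolding distribution_function_def[abs_def] by measurable
qed

text \<open>
  Hoelder's inequality between \<open>L\<^bsup>p,1\<^esup>\<close> and \<open>L\<^bsup>q,\<infinity>\<^esup>\<close>: slice \<open>g\<close> into its superlevel sets and
  bound the integral of \<open>h\<close> over each of them. The factor \<open>q/(q-1)\<close> from
  \<open>weak_type_integral_on_set\<close> is the factor \<open>p\<close> in the definition of the \<open>L\<^bsup>p,1\<^esup>\<close> quasi-norm, so
  that no constant is lost.
\<close>
lemma lorentz_holder:
  assumes sf: "sigma_finite_measure M" and [measurable]: "g \<in> borel_measurable M" "h \<in> borel_measurable M"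
    and weak: "weak_type M q B h" and q: "q > 1" and B: "B > 0" and p: "p = q / (q - 1)"
  shows "(\<integral>\<^sup>+ x. g x * h x \<partial>M) \<le> ennreal (B powr (1 / q)) * lorentz_norm M p 1 g"
proof -
  note [measurable] = distribution_function_borel[OF sf, of g]
  have p0: "p > 0" "1 / p = 1 - 1 / q" using q by (auto simp: p field_simps)
  have "(\<integral>\<^sup>+ x. g x * h x \<partial>M) =
    (\<integral>\<^sup>+ t\<in>{0<..}. (\<integral>\<^sup>+ x. h x * indicator {x \<in> space M. ennreal t < g x} x \<partial>M) \<partial>lborel)"
    by (rule layer_cake[OF sf]) auto
  also have "\<dots> \<le> (\<integral>\<^sup>+ t. ennreal (p * B powr (1 / q)) * (epowr (distribution_function M g t) (1 / p) * indicator {0<..} t) \<partial>lborel)"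
  proof (rule nn_integral_mono)
    fix t :: real
    let ?E = "{x \<in> space M. ennreal t < g x}"
    have "(\<integral>\<^sup>+ x. h x * indicator ?E x \<partial>M) \<le> ennreal (p * B powr (1 / q)) * epowr (emeasure M ?E) (1 / p)"
    proof (cases "emeasure M ?E")
      case (real v)
      then show ?thesis
        using weak_type_integral_on_set[OF sf _ weak q B, of ?E v] p0
        by (simp add: epowr_def ennreal_mult'[symmetric] p[symmetric])
    next
      case top
      then show ?thesis using p0 B by (simp add: epowr_def ennreal_mult_top)
    qed
    then show "(\<integral>\<^sup>+ x. h x * indicator ?E x \<partial>M) * indicator {0<..} t
      \<le> ennreal (p * B powr (1 / q)) * (epowr (distribution_function M g t) (1 / p) * indicator {0<..} t)"
      by (auto simp: distribution_function_def split: split_indicator)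
  qed
  also have "\<dots> = ennreal (p * B powr (1 / q)) * (\<integral>\<^sup>+ t\<in>{0<..}. epowr (distribution_function M g t) (1 / p) \<partial>lborel)"
    by (rule nn_integral_cmult) measurable
  also have "\<dots> = ennreal (B powr (1 / q)) * lorentz_norm M p 1 g"
    using p0 by (simp add: lorentz_norm_1 ennreal_mult mult_ac)
  finally show ?thesis .
qed

lemma weak_type_scaled:
  assumes weak: "weak_type M q B (\<lambda>x. ennreal (h x))" and pos: "\<And>x. h x > 0" "c > 0" and "B > 0" "s > 0"
  shows "emeasure M {x \<in> space M. ennreal s < ennreal (h x) * ennreal c} \<le> ennreal (B * s powr - q) * ennreal (c powr q)"
proof -
  have "(ennreal s < ennreal (h x) * ennreal c) = (ennreal (s / c) < ennreal (h x))" for x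
    using assms less_imp_le[OF pos(1)[of x]]
    by (simp add: ennreal_mult[symmetric] ennreal_less_iff field_simps)
  then have "emeasure M {x \<in> space M. ennreal s < ennreal (h x) * ennreal c} \<le> ennreal (B * (s / c) powr - q)"
    using weak assms by (simp add: weak_type_def distribution_function_def)
  also have "B * (s / c) powr - q = (B * s powr - q) * c powr q"
    using assms by (simp add: powr_divide powr_minus field_simps)
  finally show ?thesis using assms by (simp add: ennreal_mult)
qed

text \<open>
  A tensor product of two functions in \<open>L\<^bsup>q,\<infinity>\<^esup>\<close> is in general not in \<open>L\<^bsup>q,\<infinity>\<^esup>\<close>, but it is if one of
  them is in \<open>L\<^sup>q\<close>: on each slice the distribution function of the weak factor is rescaled by the
  value of the strong factor, and these bounds are integrated.
\<close>
lemma weak_type_prod: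
  fixes h1 :: "'a \<Rightarrow> real" and h2 :: "'b \<Rightarrow> real"
  assumes "sigma_finite_measure M1" "sigma_finite_measure M2"
    and [measurable]: "h1 \<in> borel_measurable M1" "h2 \<in> borel_measurable M2"
    and pos: "\<And>x. h1 x > 0" "\<And>y. h2 y > 0" and B: "B > 0" and N: "N > 0"
    and weak: "weak_type M1 q B (\<lambda>x. ennreal (h1 x)) \<and> (\<integral>\<^sup>+ y. ennreal (h2 y powr q) \<partial>M2) \<le> ennreal N
      \<or> weak_type M2 q B (\<lambda>y. ennreal (h2 y)) \<and> (\<integral>\<^sup>+ x. ennreal (h1 x powr q) \<partial>M1) \<le> ennreal N"
  shows "weak_type (M1 \<Otimes>\<^sub>M M2) q (B * N) (\<lambda>z. ennreal (h1 (fst z)) * ennreal (h2 (snd z)))"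
  unfolding weak_type_def
proof (intro allI impI)
  interpret M1: sigma_finite_measure M1 by fact
  interpret M2: sigma_finite_measure M2 by fact
  interpret P: pair_sigma_finite M1 M2 ..
  fix s :: real assume s: "s > 0"
  let ?A = "{z \<in> space (M1 \<Otimes>\<^sub>M M2). ennreal s < ennreal (h1 (fst z)) * ennreal (h2 (snd z))}"
  have "emeasure (M1 \<Otimes>\<^sub>M M2) ?A \<le> ennreal (B * s powr - q) * ennreal N"
    using weak
  proof (elim disjE conjE)
    assume w: "weak_type M1 q B (\<lambda>x. ennreal (h1 x))" and N: "(\<integral>\<^sup>+ y. ennreal (h2 y powr q) \<partial>M2) \<le> ennreal N"
    have "emeasure (M1 \<Otimes>\<^sub>M M2) ?A = (\<integral>\<^sup>+ y. emeasure M1 ((\<lambda>x. (x, y)) -` ?A) \<partial>M2)"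
      by (rule P.emeasure_pair_measure_alt2) measurable
    also have "\<dots> = (\<integral>\<^sup>+ y. emeasure M1 {x \<in> space M1. ennreal s < ennreal (h1 x) * ennreal (h2 y)} \<partial>M2)"
      by (intro nn_integral_cong arg_cong2[where f=emeasure] refl) (auto simp: space_pair_measure)
    also have "\<dots> \<le> (\<integral>\<^sup>+ y. ennreal (B * s powr - q) * ennreal (h2 y powr q) \<partial>M2)"
      by (intro nn_integral_mono weak_type_scaled w pos B s)
    also have "\<dots> = ennreal (B * s powr - q) * (\<integral>\<^sup>+ y. ennreal (h2 y powr q) \<partial>M2)"
      by (rule nn_integral_cmult) measurable
    also have "\<dots> \<le> ennreal (B * s powr - q) * ennreal N" by (intro mult_left_mono N) auto
    finally show ?thesis .
  next
    assume w: "weak_type M2 q B (\<lambda>y. ennreal (h2 y))" and N: "(\<integral>\<^sup>+ x. ennreal (h1 x powr q) \<partial>M1) \<le> ennreal N"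
    have "emeasure (M1 \<Otimes>\<^sub>M M2) ?A = (\<integral>\<^sup>+ x. emeasure M2 (Pair x -` ?A) \<partial>M1)"
      by (rule M2.emeasure_pair_measure_alt) measurable
    also have "\<dots> = (\<integral>\<^sup>+ x. emeasure M2 {y \<in> space M2. ennreal s < ennreal (h2 y) * ennreal (h1 x)} \<partial>M1)"
      by (intro nn_integral_cong arg_cong2[where f=emeasure] refl) (auto simp: space_pair_measure mult.commute)
    also have "\<dots> \<le> (\<integral>\<^sup>+ x. ennreal (B * s powr - q) * ennreal (h1 x powr q) \<partial>M1)"
      by (intro nn_integral_mono weak_type_scaled w pos B s)
    also have "\<dots> = ennreal (B * s powr - q) * (\<integral>\<^sup>+ x. ennreal (h1 x powr q) \<partial>M1)"
      by (rule nn_integral_cmult) measurable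
    also have "\<dots> \<le> ennreal (B * s powr - q) * ennreal N" by (intro mult_left_mono N) auto
    finally show ?thesis .
  qed
  also have "\<dots> = ennreal (B * N * s powr - q)"
    using B N by (simp add: ennreal_mult[symmetric] mult_ac)
  finally show "distribution_function (M1 \<Otimes>\<^sub>M M2) (\<lambda>z. ennreal (h1 (fst z)) * ennreal (h2 (snd z))) s
      \<le> ennreal (B * N * s powr - q)"
    by (simp add: distribution_function_def)
qed

section \<open>The averaged kernel as a functional on \<open>X\<^sub>p\<close>\<close>
lemma decay_le_1:
  assumes "DIM('a) \<ge> 2"
  shows "decay (z :: 'a::euclidean_space) \<le> 1"
proof -
  have "max 1 (norm z) powr (- ((real DIM('a) - 1) / 2)) \<le> max 1 (norm z) powr 0"
    using assms by (intro powr_mono) auto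
  also have "\<dots> = 1" by (subst powr_zero_eq_one) auto
  finally show ?thesis by (simp add: decay_def)
qed

text \<open>
  A superlevel set of \<open>decay(\<rho> x)\<close> at a height \<open>s < 1\<close> is a ball of radius
  \<open>s\<^bsup>-2/(a-1)\<^esup> / \<rho>\<close>, where \<open>a = DIM('a)\<close>. Its volume gives the critical exponent
  \<open>2a/(a-1)\<close>; larger exponents are allowed since the superlevel sets at heights \<open>s \<ge> 1\<close>
  are empty.
\<close>
lemma weak_type_decay:
  assumes dim: "DIM('a::euclidean_space) \<ge> 2" and \<rho>: "\<rho> > 0"
    and q: "q \<ge> 2 * real DIM('a) / (real DIM('a) - 1)"
  shows "weak_type lborel q (unit_ball_vol DIM('a) * \<rho> powr - real DIM('a)) (\<lambda>x::'a. ennreal (decay (\<rho> *\<^sub>R x)))"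
  unfolding weak_type_def
proof (intro allI impI)
  fix s :: real assume s: "s > 0"
  define a where "a = real DIM('a)"
  have a: "a \<ge> 2" using dim by (simp add: a_def)
  let ?E = "{x \<in> space lborel. ennreal s < ennreal (decay (\<rho> *\<^sub>R x :: 'a))}"
  show "distribution_function lborel (\<lambda>x::'a. ennreal (decay (\<rho> *\<^sub>R x))) s
      \<le> ennreal (unit_ball_vol DIM('a) * \<rho> powr - real DIM('a) * s powr - q)"
  proof (cases "s < 1")
    case False
    have "?E = {}"
    proof -
      have "ennreal (decay (\<rho> *\<^sub>R x)) \<le> ennreal s" for x :: 'a
        using decay_le_1[OF dim, of "\<rho> *\<^sub>R x"] False by (intro ennreal_leI) linarith
      then show ?thesis by (auto simp: not_less[symmetric])
    qed
    then show ?thesis by (simp only: distribution_function_def) simp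
  next
    case True
    define R where "R = s powr - (2 / (a - 1)) / \<rho>"
    have "?E \<subseteq> ball 0 R"
    proof
      fix x :: 'a assume "x \<in> ?E"
      then have "s < decay (\<rho> *\<^sub>R x)" using s by (simp add: ennreal_less_iff)
      then have "s < max 1 (\<rho> * norm x) powr (- ((a - 1) / 2))" using \<rho> by (simp add: decay_def a_def)
      then have "(max 1 (\<rho> * norm x) powr (- ((a - 1) / 2))) powr (- (2 / (a - 1))) < s powr (- (2 / (a - 1)))"
        using s a by (intro powr_less_mono2_neg) auto
      moreover have "(max 1 (\<rho> * norm x) powr (- ((a - 1) / 2))) powr (- (2 / (a - 1))) = max 1 (\<rho> * norm x)"
      proof -
        have e: "- ((a - 1) / 2) * - (2 / (a - 1)) = 1" using a by (simp add: field_simps)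
        show ?thesis unfolding powr_powr e by simp
      qed
      ultimately have "\<rho> * norm x < s powr (- (2 / (a - 1)))" by simp
      then show "x \<in> ball 0 R" using \<rho> by (simp add: R_def field_simps)
    qed
    then have "emeasure lborel ?E \<le> emeasure lborel (ball (0::'a) R)" by (intro emeasure_mono) auto
    also have "\<dots> = ennreal (unit_ball_vol DIM('a) * R ^ DIM('a))"
      using \<rho> by (intro emeasure_ball) (simp add: R_def)
    also have "R ^ DIM('a) = \<rho> powr - a * s powr - (2 * a / (a - 1))"
    proof -
      have R: "R = \<rho> powr - 1 * s powr - (2 / (a - 1))" using \<rho> by (simp add: R_def powr_minus divide_inverse mult.commute)
      moreover have "R > 0" using \<rho> s by (simp add: R_def)
      ultimately have "R ^ DIM('a) = (\<rho> powr - 1 * s powr - (2 / (a - 1))) powr a"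
        by (simp only: a_def powr_realpow)
      moreover have "- 1 * a = - a" "- (2 / (a - 1)) * a = - (2 * a / (a - 1))" by simp_all
      ultimately show ?thesis by (simp only: powr_mult powr_powr powr_ge_zero)
    qed
    also have "ennreal (unit_ball_vol DIM('a) * (\<rho> powr - a * s powr - (2 * a / (a - 1))))
        \<le> ennreal (unit_ball_vol DIM('a) * (\<rho> powr - a * s powr - q))"
      using True s q by (intro ennreal_leI mult_left_mono powr_mono') (auto simp: a_def)
    finally show ?thesis by (simp add: distribution_function_def a_def mult.assoc)
  qed
qed

text \<open>Above the critical exponent \<open>q0\<close> the kernel is in \<open>L\<^sup>q\<close>: its \<open>q\<close>-th power is bounded and
  has a distribution function of order \<open>t\<^bsup>-q0/q\<^esup>\<close>, which is integrable on the heights below \<open>1\<close>.\<close>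
lemma nn_integral_decay_powr:
  assumes dim: "DIM('a::euclidean_space) \<ge> 2" and \<rho>: "\<rho> > 0"
    and q0: "q0 = 2 * real DIM('a) / (real DIM('a) - 1)" and q: "q > q0"
  shows "(\<integral>\<^sup>+ x. ennreal (decay (\<rho> *\<^sub>R x :: 'a) powr q) \<partial>lborel)
    \<le> ennreal (unit_ball_vol DIM('a) * \<rho> powr - real DIM('a) * (1 / (1 - q0 / q)))"
proof -
  define V where "V = unit_ball_vol DIM('a) * \<rho> powr - real DIM('a)"
  have V: "V \<ge> 0" by (simp add: V_def)
  have "q0 > 0" using dim by (simp add: q0)
  then have q': "q > 0" "q0 / q < 1" using q by auto
  have weak: "weak_type lborel q0 V (\<lambda>x::'a. ennreal (decay (\<rho> *\<^sub>R x)))"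
    unfolding V_def by (rule weak_type_decay[OF dim \<rho>]) (simp add: q0)
  have "(\<integral>\<^sup>+ x. ennreal (decay (\<rho> *\<^sub>R x :: 'a) powr q) * 1 \<partial>lborel)
     = (\<integral>\<^sup>+ t\<in>{0<..}. (\<integral>\<^sup>+ x. 1 * indicator {x \<in> space lborel. ennreal t < ennreal (decay (\<rho> *\<^sub>R x :: 'a) powr q)} x \<partial>lborel) \<partial>lborel)"
    by (rule layer_cake[OF sigma_finite_lborel]) measurable
  also have "\<dots> \<le> (\<integral>\<^sup>+ t. ennreal V * (ennreal (t powr - (q0 / q)) * indicator {0..1} t) \<partial>lborel)"
  proof (rule nn_integral_mono)
    fix t :: real
    let ?E = "{x \<in> space lborel. ennreal t < ennreal (decay (\<rho> *\<^sub>R x :: 'a) powr q)}"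
    have E: "(\<integral>\<^sup>+ x. 1 * indicator ?E x \<partial>lborel) = emeasure lborel ?E" by simp
    have big: "?E = {}" if "t \<ge> 1"
    proof -
      have "decay (\<rho> *\<^sub>R x) powr q \<le> 1" for x :: 'a
        using decay_le_1[OF dim, of "\<rho> *\<^sub>R x"] decay_pos[of "\<rho> *\<^sub>R x"] q' by (intro powr_le1) auto
      then have "ennreal (decay (\<rho> *\<^sub>R x) powr q) \<le> ennreal t" for x :: 'a
        using that by (intro ennreal_leI) (meson order_trans)
      then show ?thesis by (auto simp: not_less[symmetric])
    qed
    have small: "emeasure lborel ?E \<le> ennreal (V * t powr - (q0 / q))" if "t > 0"
    proof -
      have "(t < decay (\<rho> *\<^sub>R x) powr q) = (t powr (1 / q) < decay (\<rho> *\<^sub>R x))" for x :: 'a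
      proof -
        have "(t powr (1 / q)) powr q = t" "(decay (\<rho> *\<^sub>R x) powr q) powr (1 / q) = decay (\<rho> *\<^sub>R x)"
          using q' that decay_pos[of "\<rho> *\<^sub>R x"] by (simp_all add: powr_powr)
        then show ?thesis
          using q' that decay_pos[of "\<rho> *\<^sub>R x"] powr_less_mono2[of q "t powr (1 / q)" "decay (\<rho> *\<^sub>R x)"]
            powr_less_mono2[of "1 / q" t "decay (\<rho> *\<^sub>R x) powr q"] by auto
      qed
      then have "?E = {x \<in> space lborel. ennreal (t powr (1 / q)) < ennreal (decay (\<rho> *\<^sub>R x :: 'a))}"
        using that by (auto simp: ennreal_less_iff)
      then have "emeasure lborel ?E \<le> ennreal (V * (t powr (1 / q)) powr - q0)"
        using weak that by (simp add: weak_type_def distribution_function_def)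
      then show ?thesis by (simp add: powr_powr)
    qed
    show "(\<integral>\<^sup>+ x. 1 * indicator ?E x \<partial>lborel) * indicator {0<..} t
        \<le> ennreal V * (ennreal (t powr - (q0 / q)) * indicator {0..1} t)"
      unfolding E using small big V
      by (cases "t \<ge> 1") (auto simp: ennreal_mult split: split_indicator)
  qed
  also have "\<dots> = ennreal V * ennreal (1 / (1 - q0 / q))"
    using q' by (subst nn_integral_cmult) (auto simp: nn_integral_powr_near_0)
  also have "\<dots> = ennreal (V * (1 / (1 - q0 / q)))"
    using q' by (intro ennreal_mult''[symmetric]) simp
  finally show ?thesis by (simp add: V_def)
qed

lemma lorentz_norm_section_borel:
  fixes f :: "'a::euclidean_space \<times> 'b::euclidean_space \<Rightarrow> complex"
  assumes [measurable]: "f \<in> borel_measurable (borel \<Otimes>\<^sub>M borel)" and "p > 0"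
  shows "(\<lambda>x. lorentz_norm_complex lborel p 1 (\<lambda>y. f (x, y))) \<in> borel_measurable borel"
proof -
  have [measurable]: "(\<lambda>z. emeasure lborel {y. ennreal (snd z) < ennreal (cmod (f (fst z, y)))})
      \<in> borel_measurable ((borel :: 'a measure) \<Otimes>\<^sub>M (borel :: real measure))"
  proof (rule lborel.measurable_emeasure)
    show "{z \<in> space (((borel :: 'a measure) \<Otimes>\<^sub>M (borel :: real measure)) \<Otimes>\<^sub>M lborel).
        snd z \<in> {y. ennreal (snd (fst z)) < ennreal (cmod (f (fst (fst z), y)))}}
      \<in> sets (((borel :: 'a measure) \<Otimes>\<^sub>M (borel :: real measure)) \<Otimes>\<^sub>M lborel)"
      unfolding mem_Collect_eq by measurable
  qed simp
  have "(\<lambda>(x, t). epowr (emeasure lborel {y. ennreal t < ennreal (cmod (f (x, y)))}) (1 / p) * indicator {0<..} t)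
      \<in> borel_measurable ((borel :: 'a measure) \<Otimes>\<^sub>M (lborel :: real measure))"
    unfolding case_prod_beta by measurable
  then show ?thesis
    using \<open>p > 0\<close> unfolding lorentz_norm_1[OF \<open>p > 0\<close>] distribution_function_def
    by (simp add: lborel.borel_measurable_nn_integral borel_measurable_times)
qed

text \<open>
  \<open>lorentz_holder\<close> is applied first in \<open>y\<close> for fixed \<open>x\<close>, then in \<open>x\<close> to the function of the inner
  quasi-norms. The iteration takes the place of a weak bound on the product of \<open>h1\<close> and \<open>h2\<close>, which
  fails in general.
\<close>
lemma mixed_lorentz_xy_holder:
  fixes f :: "'a::euclidean_space \<times> 'b::euclidean_space \<Rightarrow> complex"
  assumes [measurable]: "f \<in> borel_measurable borel" "h1 \<in> borel_measurable borel" "h2 \<in> borel_measurable borel"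
    and weak: "weak_type lborel q B1 h1" "weak_type lborel q B2 h2" and B: "B1 > 0" "B2 > 0"
    and q: "q > 1" and p: "p = q / (q - 1)"
  shows "(\<integral>\<^sup>+ z. ennreal (cmod (f z)) * (h1 (fst z) * h2 (snd z)) \<partial>lborel)
    \<le> ennreal ((B1 * B2) powr (1 / q)) * mixed_lorentz_xy p 1 f"
proof -
  have f[measurable]: "f \<in> borel_measurable (borel \<Otimes>\<^sub>M borel)" by (simp add: borel_prod)
  have p0: "p > 0" using q by (simp add: p)
  let ?L = "\<lambda>x. lorentz_norm_complex lborel p 1 (\<lambda>y. f (x, y))"
  have L[measurable]: "?L \<in> borel_measurable borel" by (rule lorentz_norm_section_borel[OF f p0])
  have "(\<integral>\<^sup>+ z. ennreal (cmod (f z)) * (h1 (fst z) * h2 (snd z)) \<partial>lborel)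
    = (\<integral>\<^sup>+ x. \<integral>\<^sup>+ y. ennreal (cmod (f (x, y))) * (h1 x * h2 y) \<partial>lborel \<partial>lborel)"
    unfolding lborel_prod[symmetric] by (subst lborel.nn_integral_fst[symmetric]) auto
  also have "\<dots> = (\<integral>\<^sup>+ x. h1 x * (\<integral>\<^sup>+ y. ennreal (cmod (f (x, y))) * h2 y \<partial>lborel) \<partial>lborel)"
    by (intro nn_integral_cong, subst nn_integral_cmult[symmetric]) (auto simp: mult_ac)
  also have "\<dots> \<le> (\<integral>\<^sup>+ x. h1 x * (ennreal (B2 powr (1 / q)) * ?L x) \<partial>lborel)"
    by (intro nn_integral_mono mult_left_mono lorentz_holder[OF sigma_finite_lborel _ _ weak(2) q B(2) p]) auto
  also have "\<dots> = ennreal (B2 powr (1 / q)) * (\<integral>\<^sup>+ x. ?L x * h1 x \<partial>lborel)"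
    by (subst nn_integral_cmult[symmetric]) (auto simp: mult_ac)
  also have "\<dots> \<le> ennreal (B2 powr (1 / q)) * (ennreal (B1 powr (1 / q)) * lorentz_norm lborel p 1 ?L)"
    by (intro mult_left_mono lorentz_holder[OF sigma_finite_lborel _ _ weak(1) q B(1) p]) auto
  also have "\<dots> = ennreal ((B1 * B2) powr (1 / q)) * mixed_lorentz_xy p 1 f"
    using B by (simp add: mixed_lorentz_xy_def powr_mult ennreal_mult mult_ac)
  finally show ?thesis .
qed

lemma nn_integral_lborel_swap:
  fixes g :: "'a::euclidean_space \<times> 'b::euclidean_space \<Rightarrow> ennreal"
  assumes "g \<in> borel_measurable borel"
  shows "(\<integral>\<^sup>+ z. g z \<partial>lborel) = (\<integral>\<^sup>+ z. g (snd z, fst z) \<partial>lborel)"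
proof -
  have [measurable]: "g \<in> borel_measurable (borel \<Otimes>\<^sub>M borel)" using assms by (simp add: borel_prod)
  have "(\<integral>\<^sup>+ z. g z \<partial>lborel) = (\<integral>\<^sup>+ y. \<integral>\<^sup>+ x. g (x, y) \<partial>lborel \<partial>lborel)"
    unfolding lborel_prod[symmetric] by (subst lborel_pair.nn_integral_snd) auto
  also have "\<dots> = (\<integral>\<^sup>+ z. g (snd z, fst z) \<partial>lborel)"
    unfolding lborel_prod[symmetric] by (subst lborel.nn_integral_fst[symmetric]) auto
  finally show ?thesis .
qed

lemma mixed_lorentz_yx_holder:
  fixes f :: "'a::euclidean_space \<times> 'b::euclidean_space \<Rightarrow> complex"
  assumes f [measurable]: "f \<in> borel_measurable borel" and [measurable]: "h1 \<in> borel_measurable borel" "h2 \<in> borel_measurable borel"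
    and weak: "weak_type lborel q B1 h1" "weak_type lborel q B2 h2" and B: "B1 > 0" "B2 > 0"
    and q: "q > 1" and p: "p = q / (q - 1)"
  shows "(\<integral>\<^sup>+ z. ennreal (cmod (f z)) * (h1 (fst z) * h2 (snd z)) \<partial>lborel)
    \<le> ennreal ((B1 * B2) powr (1 / q)) * mixed_lorentz_yx p 1 f"
proof -
  have f'[measurable]: "f \<in> borel_measurable (borel \<Otimes>\<^sub>M borel)" using f by (simp add: borel_prod)
  have swap[measurable]: "(\<lambda>z. f (snd z, fst z)) \<in> borel_measurable borel"
    unfolding borel_prod[symmetric] by measurable
  have "(\<lambda>z. ennreal (cmod (f z)) * (h1 (fst z) * h2 (snd z))) \<in> borel_measurable borel"
    unfolding borel_prod[symmetric] by measurable
  from nn_integral_lborel_swap[OF this]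
  have "(\<integral>\<^sup>+ z. ennreal (cmod (f z)) * (h1 (fst z) * h2 (snd z)) \<partial>lborel)
    = (\<integral>\<^sup>+ z. ennreal (cmod (f (snd z, fst z))) * (h2 (fst z) * h1 (snd z)) \<partial>lborel)"
    by (simp add: mult.commute)
  also have "\<dots> \<le> ennreal ((B2 * B1) powr (1 / q)) * mixed_lorentz_xy p 1 (\<lambda>z. f (snd z, fst z))"
    by (rule mixed_lorentz_xy_holder[OF swap _ _ weak(2,1) B(2,1) q p]) auto
  also have "\<dots> = ennreal ((B1 * B2) powr (1 / q)) * mixed_lorentz_yx p 1 f"
    by (simp add: mixed_lorentz_xy_def mixed_lorentz_yx_def mult.commute)
  finally show ?thesis .
qed

lemma mixed_lorentz_sum_holder:
  fixes f :: "'a::euclidean_space \<times> 'b::euclidean_space \<Rightarrow> complex"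
  assumes f [measurable]: "f \<in> borel_measurable borel" and h [measurable]: "h1 \<in> borel_measurable borel" "h2 \<in> borel_measurable borel"
    and weak: "weak_type lborel q B1 h1" "weak_type lborel q B2 h2" and B: "B1 > 0" "B2 > 0"
    and q: "q > 1" and p: "p = q / (q - 1)"
  shows "(\<integral>\<^sup>+ z. ennreal (cmod (f z)) * (h1 (fst z) * h2 (snd z)) \<partial>lborel)
    \<le> ennreal ((B1 * B2) powr (1 / q)) * mixed_lorentz_sum p 1 f"
proof -
  define c where "c = ennreal ((B1 * B2) powr (1 / q))"
  have c: "c > 0" "c < \<infinity>" using B by (simp_all add: c_def)
  define H where "H z = h1 (fst z) * h2 (snd z)" for z
  have [measurable]: "H \<in> borel_measurable borel" unfolding H_def borel_prod[symmetric] by measurable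
  let ?I = "\<lambda>f. \<integral>\<^sup>+ z. ennreal (cmod (f z)) * H z \<partial>lborel"
  \<comment> \<open>The constant is moved to the left, where it does not interfere with the infimum.\<close>
  have "?I f / c \<le> mixed_lorentz_sum p 1 f"
    unfolding mixed_lorentz_sum_def
  proof (rule Inf_greatest, clarify)
    fix f1 f2 :: "'a \<times> 'b \<Rightarrow> complex"
    assume m: "f1 \<in> borel_measurable lborel" "f2 \<in> borel_measurable lborel"
      and eq: "AE z in lborel. f z = f1 z + f2 z"
    from m have [measurable]: "f1 \<in> borel_measurable borel" "f2 \<in> borel_measurable borel" by simp_all
    have "?I f \<le> (\<integral>\<^sup>+ z. ennreal (cmod (f1 z)) * H z + ennreal (cmod (f2 z)) * H z \<partial>lborel)"
    proof (rule nn_integral_mono_AE)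
      show "AE z in lborel. ennreal (cmod (f z)) * H z \<le> ennreal (cmod (f1 z)) * H z + ennreal (cmod (f2 z)) * H z"
        using eq
      proof eventually_elim
        case (elim z)
        have "ennreal (cmod (f z)) \<le> ennreal (cmod (f1 z)) + ennreal (cmod (f2 z))"
          unfolding elim by (simp add: ennreal_plus[symmetric] norm_triangle_ineq del: ennreal_plus)
        then show ?case unfolding distrib_right[symmetric] by (rule mult_right_mono) simp
      qed
    qed
    also have "\<dots> = ?I f1 + ?I f2" by (rule nn_integral_add) measurable
    also have "\<dots> \<le> c * mixed_lorentz_xy p 1 f1 + c * mixed_lorentz_yx p 1 f2"
      unfolding c_def H_def
      by (intro add_mono mixed_lorentz_xy_holder mixed_lorentz_yx_holder) (use weak B q p in auto)
    finally show "?I f / c \<le> mixed_lorentz_xy p 1 f1 + mixed_lorentz_yx p 1 f2"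
      using c by (intro divide_le_posI_ennreal) (auto simp: distrib_left)
  qed
  then have "c * (?I f / c) \<le> c * mixed_lorentz_sum p 1 f" by (rule mult_left_mono) simp
  also have "c * (?I f / c) = ?I f"
    using c by (simp add: ennreal_times_divide mult.commute[of c] mult_divide_eq_ennreal)
  finally show ?thesis by (simp add: c_def H_def)
qed

text \<open>
  The exponent \<open>q\<close> is critical for the block of dimension \<open>m\<close> and, if the dimensions differ,
  supercritical for the other block. This decides between \<open>weak_type_prod\<close> on the whole space and
  the mixed norms, in accordance with the case distinction in \<open>X_norm\<close>.
\<close>
lemma X_norm_holder:
  fixes m p q :: real
  assumes dim: "DIM('a::euclidean_space) \<ge> 2" "DIM('b::euclidean_space) \<ge> 2"
    and m: "m = real (min DIM('a) DIM('b))" and p: "p = 2 * m / (m + 1)" and q: "q = 2 * m / (m - 1)"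
  obtains c where "c > 0"
    "\<And>(f :: 'a \<times> 'b \<Rightarrow> complex) \<rho> \<tau>. f \<in> borel_measurable borel \<Longrightarrow> \<rho> > 0 \<Longrightarrow> \<tau> > 0 \<Longrightarrow>
      (\<integral>\<^sup>+ z. ennreal (cmod (f z)) * (ennreal (decay (\<rho> *\<^sub>R fst z)) * ennreal (decay (\<tau> *\<^sub>R snd z))) \<partial>lborel)
      \<le> ennreal (c * (\<rho> powr - real DIM('a) * \<tau> powr - real DIM('b)) powr (1 / q)) * X_norm p f"
proof -
  define a b where "a = real DIM('a)" and "b = real DIM('b)"
  define Va Vb where "Va = unit_ball_vol a" and "Vb = unit_ball_vol b"
  have V: "Va > 0" "Vb > 0" unfolding Va_def Vb_def a_def b_def by (rule unit_ball_vol_pos; simp)+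
  have ab: "a \<ge> 2" "b \<ge> 2" using dim by (simp_all add: a_def b_def)
  have m': "m = min a b" by (simp add: m a_def b_def of_nat_min)
  then have m2: "m \<ge> 2" using ab by simp
  have q1: "q > 1" using m2 by (simp add: q field_simps)
  have pq: "p = q / (q - 1)"
  proof -
    have "q - 1 = (m + 1) / (m - 1)" using m2 by (simp add: q field_simps)
    then show ?thesis using m2 by (simp add: p q)
  qed
  have expo: "2 * n / (n - 1) \<le> q" "m < n \<Longrightarrow> 2 * n / (n - 1) < q" if "n \<ge> m" for n
    using that m2 by (simp_all add: q field_simps)
  have weak_a: "weak_type lborel q (Va * \<rho> powr - a) (\<lambda>x::'a. ennreal (decay (\<rho> *\<^sub>R x)))" if "\<rho> > 0" for \<rho>
    unfolding Va_def a_def using expo(1)[of a] m' that dim(1)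
    by (intro weak_type_decay) (auto simp: a_def)
  have weak_b: "weak_type lborel q (Vb * \<tau> powr - b) (\<lambda>y::'b. ennreal (decay (\<tau> *\<^sub>R y)))" if "\<tau> > 0" for \<tau>
    unfolding Vb_def b_def using expo(1)[of b] m' that dim(2)
    by (intro weak_type_decay) (auto simp: b_def)
  have cond: "real (min DIM('a) DIM('b)) < real DIM('a \<times> 'b) / 2 \<longleftrightarrow> a \<noteq> b"
    by (auto simp: a_def b_def of_nat_min min_def)
  show ?thesis
  proof (cases "a = b")
    case True
    show ?thesis
    proof (rule that[of "(Va * Vb) powr (1 / q)"])
      show "(Va * Vb) powr (1 / q) > 0" using V by simp
      fix f :: "'a \<times> 'b \<Rightarrow> complex" and \<rho> \<tau> :: real
      assume [measurable]: "f \<in> borel_measurable borel" and \<rho>: "\<rho> > 0" and \<tau>: "\<tau> > 0"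
      have "(\<integral>\<^sup>+ z. ennreal (cmod (f z)) * (ennreal (decay (\<rho> *\<^sub>R fst z)) * ennreal (decay (\<tau> *\<^sub>R snd z))) \<partial>lborel)
        \<le> ennreal ((Va * \<rho> powr - a * (Vb * \<tau> powr - b)) powr (1 / q)) * mixed_lorentz_sum p 1 f"
        using V \<rho> \<tau> by (intro mixed_lorentz_sum_holder[OF _ _ _ weak_a[OF \<rho>] weak_b[OF \<tau>] _ _ q1 pq]) auto
      also have "(Va * \<rho> powr - a * (Vb * \<tau> powr - b)) powr (1 / q)
          = (Va * Vb) powr (1 / q) * (\<rho> powr - a * \<tau> powr - b) powr (1 / q)"
        using V by (subst powr_mult[symmetric]) (auto simp: mult_ac)
      also have "mixed_lorentz_sum p 1 f = X_norm p f"
        unfolding X_norm_def cond using True by simp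
      finally show "(\<integral>\<^sup>+ z. ennreal (cmod (f z)) * (ennreal (decay (\<rho> *\<^sub>R fst z)) * ennreal (decay (\<tau> *\<^sub>R snd z))) \<partial>lborel)
        \<le> ennreal ((Va * Vb) powr (1 / q) * (\<rho> powr - real DIM('a) * \<tau> powr - real DIM('b)) powr (1 / q)) * X_norm p f"
        by (simp add: a_def b_def)
    qed
  next
    case False
    obtain \<kappa> where \<kappa>: "\<kappa> > 0" and weak: "\<And>\<rho> \<tau>. \<rho> > 0 \<Longrightarrow> \<tau> > 0 \<Longrightarrow>
      weak_type (lborel :: ('a \<times> 'b) measure) q (Va * Vb * \<kappa> * (\<rho> powr - a * \<tau> powr - b))
        (\<lambda>z. ennreal (decay (\<rho> *\<^sub>R fst z)) * ennreal (decay (\<tau> *\<^sub>R snd z)))"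
    proof (cases "a < b")
      case True
      define q0 where "q0 = 2 * b / (b - 1)"
      have q0: "q0 < q" "q0 > 0" using True expo(2)[of b] m' ab by (auto simp: q0_def)
      show ?thesis
      proof (rule that[of "1 / (1 - q0 / q)"])
        show "1 / (1 - q0 / q) > 0" using q0 by simp
        fix \<rho> \<tau> :: real assume pos: "\<rho> > 0" "\<tau> > 0"
        have "(\<integral>\<^sup>+ y. ennreal (decay (\<tau> *\<^sub>R y :: 'b) powr q) \<partial>lborel) \<le> ennreal (Vb * \<tau> powr - b * (1 / (1 - q0 / q)))"
          unfolding Vb_def b_def using dim pos q0 by (intro nn_integral_decay_powr) (auto simp: q0_def b_def)
        then have "weak_type (lborel \<Otimes>\<^sub>M lborel) q (Va * \<rho> powr - a * (Vb * \<tau> powr - b * (1 / (1 - q0 / q))))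
          (\<lambda>z. ennreal (decay (\<rho> *\<^sub>R fst z :: 'a)) * ennreal (decay (\<tau> *\<^sub>R snd z :: 'b)))"
          using V pos q0 weak_a[OF pos(1)]
          by (intro weak_type_prod[OF sigma_finite_lborel sigma_finite_lborel]) (auto simp: decay_pos)
        then show "weak_type (lborel :: ('a \<times> 'b) measure) q (Va * Vb * (1 / (1 - q0 / q)) * (\<rho> powr - a * \<tau> powr - b))
          (\<lambda>z. ennreal (decay (\<rho> *\<^sub>R fst z)) * ennreal (decay (\<tau> *\<^sub>R snd z)))"
          by (simp only: lborel_prod mult_ac)
      qed
    next
      case False
      with \<open>a \<noteq> b\<close> have "b < a" by simp
      define q0 where "q0 = 2 * a / (a - 1)"
      have q0: "q0 < q" "q0 > 0" using \<open>b < a\<close> expo(2)[of a] m' ab by (auto simp: q0_def)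
      show ?thesis
      proof (rule that[of "1 / (1 - q0 / q)"])
        show "1 / (1 - q0 / q) > 0" using q0 by simp
        fix \<rho> \<tau> :: real assume pos: "\<rho> > 0" "\<tau> > 0"
        have "(\<integral>\<^sup>+ x. ennreal (decay (\<rho> *\<^sub>R x :: 'a) powr q) \<partial>lborel) \<le> ennreal (Va * \<rho> powr - a * (1 / (1 - q0 / q)))"
          unfolding Va_def a_def using dim pos q0 by (intro nn_integral_decay_powr) (auto simp: q0_def a_def)
        then have "weak_type (lborel \<Otimes>\<^sub>M lborel) q (Vb * \<tau> powr - b * (Va * \<rho> powr - a * (1 / (1 - q0 / q))))
          (\<lambda>z. ennreal (decay (\<rho> *\<^sub>R fst z :: 'a)) * ennreal (decay (\<tau> *\<^sub>R snd z :: 'b)))"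
          using V pos q0 weak_b[OF pos(2)]
          by (intro weak_type_prod[OF sigma_finite_lborel sigma_finite_lborel]) (auto simp: decay_pos)
        then show "weak_type (lborel :: ('a \<times> 'b) measure) q (Va * Vb * (1 / (1 - q0 / q)) * (\<rho> powr - a * \<tau> powr - b))
          (\<lambda>z. ennreal (decay (\<rho> *\<^sub>R fst z)) * ennreal (decay (\<tau> *\<^sub>R snd z)))"
          by (simp only: lborel_prod mult_ac)
      qed
    qed
    show ?thesis
    proof (rule that[of "(Va * Vb * \<kappa>) powr (1 / q)"])
      show "(Va * Vb * \<kappa>) powr (1 / q) > 0" using V \<kappa> by simp
      fix f :: "'a \<times> 'b \<Rightarrow> complex" and \<rho> \<tau> :: real
      assume [measurable]: "f \<in> borel_measurable borel" and pos: "\<rho> > 0" "\<tau> > 0"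
      have [measurable]: "(\<lambda>z. ennreal (decay (\<rho> *\<^sub>R fst z)) * ennreal (decay (\<tau> *\<^sub>R snd z))) \<in> borel_measurable (borel :: ('a \<times> 'b) measure)"
        unfolding borel_prod[symmetric] by measurable
      have "(\<integral>\<^sup>+ z. ennreal (cmod (f z)) * (ennreal (decay (\<rho> *\<^sub>R fst z)) * ennreal (decay (\<tau> *\<^sub>R snd z))) \<partial>lborel)
        \<le> ennreal ((Va * Vb * \<kappa> * (\<rho> powr - a * \<tau> powr - b)) powr (1 / q)) * lorentz_norm_complex lborel p 1 f"
        using V \<kappa> pos by (intro lorentz_holder[OF sigma_finite_lborel _ _ weak[OF pos] q1 _ pq]) auto
      also have "(Va * Vb * \<kappa> * (\<rho> powr - a * \<tau> powr - b)) powr (1 / q)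
          = (Va * Vb * \<kappa>) powr (1 / q) * (\<rho> powr - a * \<tau> powr - b) powr (1 / q)"
        by (rule powr_mult)
      also have "lorentz_norm_complex lborel p 1 f = X_norm p f"
        unfolding X_norm_def cond using False by simp
      finally show "(\<integral>\<^sup>+ z. ennreal (cmod (f z)) * (ennreal (decay (\<rho> *\<^sub>R fst z)) * ennreal (decay (\<tau> *\<^sub>R snd z))) \<partial>lborel)
        \<le> ennreal ((Va * Vb * \<kappa>) powr (1 / q) * (\<rho> powr - real DIM('a) * \<tau> powr - real DIM('b)) powr (1 / q)) * X_norm p f"
        by (simp add: a_def b_def)
    qed
  qed
qed

section \<open>Functions with singularities along two subspheres\<close>
lemma space_surface_measure: "space surface_measure = sphere (0::'a::euclidean_space) 1"
  by (simp add: surface_measure_def space_scale_measure space_restrict_space)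

text \<open>
  The surface measure of a set is the dimension times the volume of the cone over it, and \<open>S\<close> covers
  that cone.
\<close>
lemma surface_measure_le:
  fixes P :: "'a::euclidean_space \<Rightarrow> bool"
  assumes [measurable]: "Measurable.pred borel P" and S [measurable]: "S \<in> sets borel"
    and sub: "\<And>u. u \<noteq> 0 \<Longrightarrow> norm u < 1 \<Longrightarrow> P (u /\<^sub>R norm u) \<Longrightarrow> u \<in> S"
  shows "emeasure surface_measure {\<omega> \<in> space surface_measure. P \<omega>} \<le> of_nat DIM('a) * emeasure lborel S"
proof -
  let ?R = "restrict_space lborel (ball (0::'a) 1 - {0})" and ?S = "restrict_space borel (sphere (0::'a) 1)"
  let ?g = "\<lambda>x::'a. x /\<^sub>R norm x"
  have g: "?g \<in> measurable ?R ?S"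
  proof (rule measurable_restrict_space2)
    show "?g \<in> space ?R \<rightarrow> sphere 0 1" by (auto simp: space_restrict_space)
    show "?g \<in> borel_measurable ?R" by (rule measurable_restrict_space1) measurable
  qed
  have A: "{\<omega> \<in> sphere 0 1. P \<omega>} \<in> sets ?S"
  proof -
    have "{\<omega> \<in> space borel. P \<omega>} \<in> sets borel" by measurable
    then show ?thesis by (auto simp: sets_restrict_space image_iff intro!: bexI[of _ "{\<omega>. P \<omega>}"])
  qed
  have "emeasure surface_measure {\<omega> \<in> space surface_measure. P \<omega>}
      = of_nat DIM('a) * emeasure (distr ?R ?S ?g) {\<omega> \<in> sphere 0 1. P \<omega>}"
    by (simp add: space_surface_measure) (simp add: surface_measure_def)
  also have "emeasure (distr ?R ?S ?g) {\<omega> \<in> sphere 0 1. P \<omega>} = emeasure ?R (?g -` {\<omega> \<in> sphere 0 1. P \<omega>} \<inter> space ?R)"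
    using g A by (rule emeasure_distr)
  also have "\<dots> = emeasure lborel (?g -` {\<omega> \<in> sphere 0 1. P \<omega>} \<inter> space ?R)"
    by (rule emeasure_restrict_space) (auto simp: space_restrict_space)
  also have "\<dots> \<le> emeasure lborel S"
  proof (intro emeasure_mono subsetI)
    fix u assume "u \<in> ?g -` {\<omega> \<in> sphere 0 1. P \<omega>} \<inter> space ?R"
    then show "u \<in> S" by (intro sub) (auto simp: space_restrict_space)
  qed simp
  finally show ?thesis by (simp add: mult_left_mono)
qed

text \<open>The cone over the \<open>\<epsilon>\<close>-neighbourhood of a subsphere lies in a product of two balls, one of
  radius \<open>\<epsilon>\<close> and one of radius \<open>1\<close>.\<close>
lemma surface_measure_near_subspace:
  fixes \<epsilon> :: real
  assumes \<epsilon>: "\<epsilon> \<ge> 0"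
  shows "emeasure surface_measure {\<omega> \<in> space surface_measure. norm (fst (\<omega> :: 'a::euclidean_space \<times> 'b::euclidean_space)) \<le> \<epsilon>}
      \<le> ennreal (real DIM('a \<times> 'b) * unit_ball_vol DIM('a) * unit_ball_vol DIM('b) * \<epsilon> ^ DIM('a))" (is ?fst)
    and "emeasure surface_measure {\<omega> \<in> space surface_measure. norm (snd (\<omega> :: 'a::euclidean_space \<times> 'b::euclidean_space)) \<le> \<epsilon>}
      \<le> ennreal (real DIM('a \<times> 'b) * unit_ball_vol DIM('a) * unit_ball_vol DIM('b) * \<epsilon> ^ DIM('b))" (is ?snd)
proof -
  have emeasure_Times: "emeasure lborel (A \<times> B) = emeasure lborel A * emeasure lborel B"
    if "A \<in> sets borel" "B \<in> sets borel" for A :: "'a set" and B :: "'b set"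
    unfolding lborel_prod[symmetric] using that by (intro lborel.emeasure_pair_measure_Times) auto
  have Times_borel: "A \<times> B \<in> sets borel" if "closed A" "closed B" for A :: "'a set" and B :: "'b set"
    using that by (intro borel_closed closed_Times)
  have d: "(of_nat n :: ennreal) = ennreal (real n)" for n by (simp add: ennreal_of_nat_eq_real_of_nat)
  have small: "norm v \<le> \<epsilon>" if "norm v / norm u \<le> \<epsilon>" "u \<noteq> 0" "norm u < 1" for u :: "'a \<times> 'b" and v :: "'c::real_normed_vector"
  proof -
    have "norm v \<le> \<epsilon> * norm u" using that by (simp add: field_simps)
    also have "\<dots> \<le> \<epsilon> * 1" using that \<epsilon> by (intro mult_left_mono) auto
    finally show ?thesis by simp
  qed
  have "Measurable.pred (borel \<Otimes>\<^sub>M borel) (\<lambda>\<omega>::'a\<times>'b. norm (fst \<omega>) \<le> \<epsilon>)" by measurable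
  then have "emeasure surface_measure {\<omega> \<in> space surface_measure. norm (fst (\<omega> :: 'a \<times> 'b)) \<le> \<epsilon>}
     \<le> of_nat DIM('a \<times> 'b) * emeasure lborel (cball (0::'a) \<epsilon> \<times> cball (0::'b) 1)"
  proof (intro surface_measure_le)
    fix u :: "'a \<times> 'b" assume "u \<noteq> 0" "norm u < 1" "norm (fst (u /\<^sub>R norm u)) \<le> \<epsilon>"
    then show "u \<in> cball 0 \<epsilon> \<times> cball 0 1"
      using small[of "fst u" u] norm_snd_le[of "snd u" "fst u"] by (cases u) (auto simp: field_simps)
  qed (auto simp: borel_prod intro!: Times_borel)
  also have "\<dots> = ennreal (real DIM('a \<times> 'b) * unit_ball_vol DIM('a) * unit_ball_vol DIM('b) * \<epsilon> ^ DIM('a))"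
    using \<epsilon> by (simp add: emeasure_Times emeasure_cball d ennreal_mult[symmetric] mult_ac del: DIM_prod)
  finally show ?fst .
  have "Measurable.pred (borel \<Otimes>\<^sub>M borel) (\<lambda>\<omega>::'a\<times>'b. norm (snd \<omega>) \<le> \<epsilon>)" by measurable
  then have "emeasure surface_measure {\<omega> \<in> space surface_measure. norm (snd (\<omega> :: 'a \<times> 'b)) \<le> \<epsilon>}
     \<le> of_nat DIM('a \<times> 'b) * emeasure lborel (cball (0::'a) 1 \<times> cball (0::'b) \<epsilon>)"
  proof (intro surface_measure_le)
    fix u :: "'a \<times> 'b" assume "u \<noteq> 0" "norm u < 1" "norm (snd (u /\<^sub>R norm u)) \<le> \<epsilon>"
    then show "u \<in> cball 0 1 \<times> cball 0 \<epsilon>"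
      using small[of "snd u" u] norm_fst_le[of "fst u" "snd u"] by (cases u) (auto simp: field_simps)
  qed (auto simp: borel_prod intro!: Times_borel)
  also have "\<dots> = ennreal (real DIM('a \<times> 'b) * unit_ball_vol DIM('a) * unit_ball_vol DIM('b) * \<epsilon> ^ DIM('b))"
    using \<epsilon> by (simp add: emeasure_Times emeasure_cball d ennreal_mult[symmetric] mult_ac del: DIM_prod)
  finally show ?snd .
qed

text \<open>
  One of the two norms on the unit sphere is at least \<open>1/2\<close>, so \<open>G\<close> can exceed \<open>t\<close> only near one
  of the subspheres \<open>\<xi> = 0\<close> and \<open>\<eta> = 0\<close>, at a distance for which \<open>surface_measure_near_subspace\<close>
  gives a measure of order \<open>(N/t)\<^bsup>q\<^esup>\<close>. These neighbourhoods contain the subspheres, where \<open>G\<close> is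
  uncontrolled.
\<close>
lemma weak_norm_of_axis_singularity:
  fixes q :: real
  assumes q: "q > 0"
  shows "\<exists>c>0. \<forall>(G :: 'a::euclidean_space \<times> 'b::euclidean_space \<Rightarrow> complex) N. N \<ge> 0 \<longrightarrow>
      (\<forall>\<xi> \<eta>. \<xi> \<noteq> 0 \<longrightarrow> \<eta> \<noteq> 0 \<longrightarrow>
        cmod (G (\<xi>, \<eta>)) \<le> N * (norm \<xi> powr - real DIM('a) * norm \<eta> powr - real DIM('b)) powr (1 / q)) \<longrightarrow>
      lorentz_norm_complex surface_measure q \<infinity> G \<le> ennreal (c * N)"
proof -
  define a b where "a = real DIM('a)" and "b = real DIM('b)"
  have ab: "a > 0" "b > 0" by (simp_all add: a_def b_def)
  define V where "V = real DIM('a \<times> 'b) * unit_ball_vol DIM('a) * unit_ball_vol DIM('b)"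
  have V: "V > 0" unfolding V_def by (intro mult_pos_pos unit_ball_vol_pos) (auto simp: add_pos_pos)
  define K where "K = V * (2 powr b + 2 powr a)"
  have K: "K > 0" using V by (simp add: K_def add_pos_pos)
  show ?thesis
  proof (intro exI[of _ "K powr (1 / q)"] conjI allI impI)
    show "K powr (1 / q) > 0" using K by simp
    fix G :: "'a \<times> 'b \<Rightarrow> complex" and N :: real
    assume N: "N \<ge> 0" and G: "\<forall>\<xi> \<eta>. \<xi> \<noteq> 0 \<longrightarrow> \<eta> \<noteq> 0 \<longrightarrow>
        cmod (G (\<xi>, \<eta>)) \<le> N * (norm \<xi> powr - real DIM('a) * norm \<eta> powr - real DIM('b)) powr (1 / q)"
    have dist: "distribution_function surface_measure (\<lambda>x. ennreal (cmod (G x))) t \<le> ennreal (K * (N / t) powr q)"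
      if t: "t > 0" for t
    proof -
      \<comment> \<open>If \<open>\<tau> \<ge> 1/2\<close>, then \<open>\<rho> powr a * \<tau> powr b < \<Lambda>\<close> forces \<open>\<rho> powr a < 2 powr b * \<Lambda>\<close>;
        this determines \<open>\<epsilon>1\<close>, and \<open>\<epsilon>2\<close> arises in the same way from \<open>\<rho> \<ge> 1/2\<close>.\<close>
      define \<Lambda> where "\<Lambda> = (N / t) powr q"
      define \<epsilon>1 where "\<epsilon>1 = (2 powr b * \<Lambda>) powr (1 / a)"
      define \<epsilon>2 where "\<epsilon>2 = (2 powr a * \<Lambda>) powr (1 / b)"
      let ?A = "{\<omega> \<in> space surface_measure. norm (fst (\<omega> :: 'a \<times> 'b)) \<le> \<epsilon>1}"
      let ?B = "{\<omega> \<in> space surface_measure. norm (snd (\<omega> :: 'a \<times> 'b)) \<le> \<epsilon>2}"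
      have \<Lambda>: "\<Lambda> \<ge> 0" by (simp add: \<Lambda>_def)
      have root: "(x powr (1 / real n)) ^ n = x" if "x \<ge> 0" "n > 0" for x and n :: nat
        using that by (cases "x = 0") (auto simp: powr_realpow[symmetric] powr_powr zero_power)
      have pow1: "\<epsilon>1 ^ DIM('a) = 2 powr b * \<Lambda>" and pow2: "\<epsilon>2 ^ DIM('b) = 2 powr a * \<Lambda>"
        unfolding \<epsilon>1_def \<epsilon>2_def unfolding a_def b_def by (intro root; use \<Lambda> in simp)+
      have meas: "?A \<in> sets surface_measure" "?B \<in> sets surface_measure"
      proof -
        have *: "{\<omega> \<in> space surface_measure. P \<omega>} \<in> sets surface_measure" if "Measurable.pred (borel \<Otimes>\<^sub>M borel) P"
          for P :: "'a \<times> 'b \<Rightarrow> bool"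
        proof -
          have "{\<omega> \<in> space borel. P \<omega>} \<in> sets borel" using that unfolding borel_prod by measurable
          then show ?thesis unfolding space_surface_measure
            by (auto simp: surface_measure_def sets_restrict_space image_iff intro!: bexI[of _ "{\<omega>. P \<omega>}"])
        qed
        show "?A \<in> sets surface_measure" by (rule *) measurable
        show "?B \<in> sets surface_measure" by (rule *) measurable
      qed
      have "{\<omega> \<in> space surface_measure. ennreal t < ennreal (cmod (G \<omega>))} \<subseteq> ?A \<union> ?B"
      proof
        fix \<omega> assume "\<omega> \<in> {\<omega> \<in> space surface_measure. ennreal t < ennreal (cmod (G \<omega>))}"
        then have sp: "\<omega> \<in> space surface_measure" and lt: "t < cmod (G \<omega>)"
          using t by (auto simp: ennreal_less_iff)
        obtain \<xi> \<eta> where \<omega>: "\<omega> = (\<xi>, \<eta>)" by fastforce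
        have unit: "(norm \<xi>)\<^sup>2 + (norm \<eta>)\<^sup>2 = 1" using sp by (simp add: space_surface_measure \<omega> norm_Pair)
        show "\<omega> \<in> ?A \<union> ?B"
        proof (cases "\<xi> = 0 \<or> \<eta> = 0")
          case True
          then show ?thesis using sp by (auto simp: \<omega> \<epsilon>1_def \<epsilon>2_def)
        next
          case False
          define \<rho> \<tau> where "\<rho> = norm \<xi>" and "\<tau> = norm \<eta>"
          have pos: "\<rho> > 0" "\<tau> > 0" using False by (simp_all add: \<rho>_def \<tau>_def)
          have le: "t < N * (\<rho> powr - a * \<tau> powr - b) powr (1 / q)"
            using lt G[rule_format, of \<xi> \<eta>] False by (simp add: \<omega> a_def b_def \<rho>_def \<tau>_def)
          then have "N > 0" using t N by (cases "N = 0") auto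
          then have "t / N < (\<rho> powr - a * \<tau> powr - b) powr (1 / q)"
            using le by (simp add: field_simps)
          then have "(t / N) powr q < ((\<rho> powr - a * \<tau> powr - b) powr (1 / q)) powr q"
            using t \<open>N > 0\<close> q by (intro powr_less_mono2) auto
          also have "\<dots> = \<rho> powr - a * \<tau> powr - b" using pos q by (simp add: powr_powr)
          finally have lt': "(t / N) powr q < \<rho> powr - a * \<tau> powr - b" .
          have "(t / N) powr q * \<Lambda> = 1"
            using t \<open>N > 0\<close> by (simp add: \<Lambda>_def powr_mult[symmetric])
          moreover have "\<Lambda> > 0" using t \<open>N > 0\<close> by (simp add: \<Lambda>_def)
          moreover have "\<rho> powr - a * \<tau> powr - b * (\<rho> powr a * \<tau> powr b) = 1"
          proof -
            have "x powr - c * x powr c = 1" if "x > 0" for x c :: real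
              using that by (simp add: powr_add[symmetric])
            from this[OF pos(1), of a] this[OF pos(2), of b] show ?thesis
              by (metis mult.assoc mult.left_commute mult_1_right)
          qed
          moreover have "\<rho> powr a * \<tau> powr b > 0" using pos by simp
          moreover have "y < z" if "x * z = 1" "z > 0" "w * y = 1" "y > 0" "x < w" for x y z w :: real
          proof -
            have "w * y < w * z" using mult_strict_right_mono[OF that(5,2)] that(1,3) by simp
            moreover have "w > 0" using that(3,4) by (metis zero_less_mult_pos2 zero_less_one)
            ultimately show ?thesis by simp
          qed
          ultimately have "\<rho> powr a * \<tau> powr b < \<Lambda>" using lt' by blast
          have double: "x \<le> 2 powr c * y" if "x * (1 / 2) powr c \<le> y" for x y c :: real
          proof -
            have "2 powr c * (1 / 2) powr c = (1::real)" by (subst powr_mult[symmetric]) simp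
            then have eq: "2 powr c * (x * (1 / 2) powr c) = x" by (simp only: mult.left_commute mult_1_right)
            have "2 powr c * (x * (1 / 2) powr c) \<le> 2 powr c * y" by (intro mult_left_mono that) simp
            then show ?thesis unfolding eq .
          qed
          have half: "\<rho> \<ge> 1 / 2 \<or> \<tau> \<ge> 1 / 2"
          proof (rule ccontr)
            assume "\<not> ?thesis"
            then have "\<rho>\<^sup>2 \<le> (1 / 2)\<^sup>2" "\<tau>\<^sup>2 \<le> (1 / 2)\<^sup>2" using pos by (auto intro!: power_mono)
            then show False using unit by (simp add: \<rho>_def \<tau>_def power2_eq_square)
          qed
          then show ?thesis
          proof
            assume "\<tau> \<ge> 1 / 2"
            then have "(1 / 2) powr b \<le> \<tau> powr b" using ab by (intro powr_mono2) auto
            then have "\<rho> powr a * (1 / 2) powr b \<le> \<rho> powr a * \<tau> powr b" by (intro mult_left_mono) auto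
            then have "\<rho> powr a \<le> 2 powr b * \<Lambda>"
              using \<open>\<rho> powr a * \<tau> powr b < \<Lambda>\<close> double[of "\<rho> powr a" b \<Lambda>] by simp
            then have "(\<rho> powr a) powr (1 / a) \<le> \<epsilon>1" unfolding \<epsilon>1_def using ab by (intro powr_mono2) auto
            then show ?thesis using sp pos ab by (simp add: \<omega> \<rho>_def powr_powr)
          next
            assume "\<rho> \<ge> 1 / 2"
            then have "(1 / 2) powr a \<le> \<rho> powr a" using ab by (intro powr_mono2) auto
            then have "(1 / 2) powr a * \<tau> powr b \<le> \<rho> powr a * \<tau> powr b" by (intro mult_right_mono) auto
            then have "\<tau> powr b \<le> 2 powr a * \<Lambda>"
              using \<open>\<rho> powr a * \<tau> powr b < \<Lambda>\<close> double[of "\<tau> powr b" a \<Lambda>] by (simp add: mult.commute)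
            then have "(\<tau> powr b) powr (1 / b) \<le> \<epsilon>2" unfolding \<epsilon>2_def using ab by (intro powr_mono2) auto
            then show ?thesis using sp pos ab by (simp add: \<omega> \<tau>_def powr_powr)
          qed
        qed
      qed
      then have "distribution_function surface_measure (\<lambda>x. ennreal (cmod (G x))) t \<le> emeasure surface_measure (?A \<union> ?B)"
        unfolding distribution_function_def using meas by (intro emeasure_mono) auto
      also have "\<dots> \<le> emeasure surface_measure ?A + emeasure surface_measure ?B"
        using meas by (intro emeasure_subadditive)
      also have "\<dots> \<le> ennreal (V * (2 powr b * \<Lambda>)) + ennreal (V * (2 powr a * \<Lambda>))"
        unfolding V_def pow1[symmetric] pow2[symmetric]
        by (intro add_mono surface_measure_near_subspace) (simp_all add: \<epsilon>1_def \<epsilon>2_def)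
      also have "\<dots> = ennreal (K * \<Lambda>)"
        using V \<Lambda> by (simp add: ennreal_plus[symmetric] K_def algebra_simps del: ennreal_plus)
      finally show ?thesis by (simp add: \<Lambda>_def)
    qed
    have "ennreal t * epowr (distribution_function surface_measure (\<lambda>x. ennreal (cmod (G x))) t) (1 / q)
      \<le> ennreal (K powr (1 / q) * N)" if t: "t > 0" for t
    proof -
      define D where "D = distribution_function surface_measure (\<lambda>x. ennreal (cmod (G x))) t"
      obtain r where r: "D = ennreal r" "r \<ge> 0" "r \<le> K * (N / t) powr q"
        using dist[OF t] K unfolding D_def[symmetric] by (cases D) (auto simp: top_unique)
      have "r powr (1 / q) \<le> (K * (N / t) powr q) powr (1 / q)" using r q by (intro powr_mono2) auto
      also have "\<dots> = K powr (1 / q) * (N / t)" using K N t q by (simp add: powr_mult powr_powr)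
      finally have "t * r powr (1 / q) \<le> K powr (1 / q) * N" using t by (simp add: field_simps)
      then show ?thesis
        using t r by (simp add: D_def[symmetric] epowr_def ennreal_mult[symmetric] ennreal_leI)
    qed
    then show "lorentz_norm_complex surface_measure q \<infinity> G \<le> ennreal (K powr (1 / q) * N)"
      by (auto simp: lorentz_norm_def intro!: SUP_least)
  qed
qed

section \<open>The restriction estimate\<close>
text \<open>
  By the convention that the Bochner integral of a non-integrable function is \<open>0\<close>. Multiplication by
  the unimodular exponential affects neither measurability nor integrability. Estimates of
  \<open>fourier f\<close> from above therefore only have to be proved for integrable \<open>f\<close>.
\<close>
lemma fourier_eq_0_of_not_integrable:
  assumes "\<not> integrable lborel f"
  shows "fourier f \<xi> = 0"
proof -
  have "\<not> integrable lborel (\<lambda>x. f x * exp (- \<i> * complex_of_real (\<xi> \<bullet> x)))"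
  proof
    assume int: "integrable lborel (\<lambda>x. f x * exp (- \<i> * complex_of_real (\<xi> \<bullet> x)))"
    then have [measurable]: "(\<lambda>x. f x * exp (- \<i> * complex_of_real (\<xi> \<bullet> x))) \<in> borel_measurable borel" by auto
    have f: "f x = (f x * exp (- \<i> * complex_of_real (\<xi> \<bullet> x))) * exp (\<i> * complex_of_real (\<xi> \<bullet> x))" for x
      by (simp add: exp_minus)
    have "(\<lambda>x. (f x * exp (- \<i> * complex_of_real (\<xi> \<bullet> x))) * exp (\<i> * complex_of_real (\<xi> \<bullet> x))) \<in> borel_measurable borel"
      by measurable
    then have "f \<in> borel_measurable borel" by (simp only: f[symmetric])
    then have "f \<in> borel_measurable lborel" by simp
    then have "integrable lborel f"
      by (intro Bochner_Integration.integrable_bound[OF int]) (auto simp: norm_mult)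
    then show False using assms by simp
  qed
  then show ?thesis by (simp add: fourier_def not_integrable_integral_eq)
qed

text \<open>
  The constant is the product of those for the decay of the kernels, for the duality pairing, and for
  the weak norm on the sphere. An infinite \<open>X\<^sub>p\<close>-norm makes the right-hand side infinite, since the
  constant is positive.
\<close>
lemma block_symmetric_restriction:
  fixes m :: real
  assumes dim: "DIM('a::euclidean_space) \<ge> 2" "DIM('b::euclidean_space) \<ge> 2"
    and m: "m = real (min DIM('a) DIM('b))"
  shows "\<exists>C::real. \<forall>f :: 'a \<times> 'b \<Rightarrow> complex. block_symmetric f \<longrightarrow>
           lorentz_norm_complex surface_measure (2 * m / (m - 1)) \<infinity> (fourier f)
             \<le> ennreal C * X_norm (2 * m / (m + 1)) f"
proof -
  define q where "q = 2 * m / (m - 1)"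
  define p where "p = 2 * m / (m + 1)"
  have "m \<ge> 2" using dim by (simp add: m)
  then have q: "q > 0" by (simp add: q_def)
  obtain C1 where C1: "C1 > 0" "\<And>(f :: 'a \<times> 'b \<Rightarrow> complex) \<xi> \<eta>. integrable lborel f \<Longrightarrow> block_symmetric f \<Longrightarrow>
      ennreal (cmod (fourier f (\<xi>, \<eta>))) \<le> ennreal C1 *
        (\<integral>\<^sup>+ z. ennreal (cmod (f z)) * (ennreal (decay (norm \<xi> *\<^sub>R fst z)) * ennreal (decay (norm \<eta> *\<^sub>R snd z))) \<partial>lborel)"
    using fourier_block_bound[OF dim] by blast
  obtain C2 where C2: "C2 > 0" "\<And>(f :: 'a \<times> 'b \<Rightarrow> complex) \<rho> \<tau>. f \<in> borel_measurable borel \<Longrightarrow> \<rho> > 0 \<Longrightarrow> \<tau> > 0 \<Longrightarrow>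
      (\<integral>\<^sup>+ z. ennreal (cmod (f z)) * (ennreal (decay (\<rho> *\<^sub>R fst z)) * ennreal (decay (\<tau> *\<^sub>R snd z))) \<partial>lborel)
      \<le> ennreal (C2 * (\<rho> powr - real DIM('a) * \<tau> powr - real DIM('b)) powr (1 / q)) * X_norm p f"
    using X_norm_holder[OF dim m p_def q_def] by blast
  obtain C3 where C3: "C3 > 0" "\<forall>(G :: 'a \<times> 'b \<Rightarrow> complex) N. N \<ge> 0 \<longrightarrow>
      (\<forall>\<xi> \<eta>. \<xi> \<noteq> 0 \<longrightarrow> \<eta> \<noteq> 0 \<longrightarrow>
        cmod (G (\<xi>, \<eta>)) \<le> N * (norm \<xi> powr - real DIM('a) * norm \<eta> powr - real DIM('b)) powr (1 / q)) \<longrightarrow>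
      lorentz_norm_complex surface_measure q \<infinity> G \<le> ennreal (C3 * N)"
    using weak_norm_of_axis_singularity[OF q, where ?'a='a and ?'b='b] by (elim exE conjE) (rule that)
  have "lorentz_norm_complex surface_measure q \<infinity> (fourier f) \<le> ennreal (C3 * C1 * C2) * X_norm p f"
    if sym: "block_symmetric f" for f :: "'a \<times> 'b \<Rightarrow> complex"
  proof (cases "X_norm p f")
    case top
    then show ?thesis using C1(1) C2(1) C3(1) by (simp add: ennreal_mult_top)
  next
    case (real X)
    have "lorentz_norm_complex surface_measure q \<infinity> (fourier f) \<le> ennreal (C3 * (C1 * C2 * X))"
    proof (rule C3(2)[rule_format])
      show "C1 * C2 * X \<ge> 0" using C1(1) C2(1) real by simp
      fix \<xi> :: 'a and \<eta> :: 'b assume nz: "\<xi> \<noteq> 0" "\<eta> \<noteq> 0"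
      define W where "W = (norm \<xi> powr - real DIM('a) * norm \<eta> powr - real DIM('b)) powr (1 / q)"
      have W: "W \<ge> 0" by (simp add: W_def)
      show "cmod (fourier f (\<xi>, \<eta>)) \<le> C1 * C2 * X * (norm \<xi> powr - real DIM('a) * norm \<eta> powr - real DIM('b)) powr (1 / q)"
      proof (cases "integrable lborel f")
        case False
        then show ?thesis using C1(1) C2(1) real by (simp add: fourier_eq_0_of_not_integrable)
      next
        case True
        then have "f \<in> borel_measurable borel" by auto
        have "ennreal (cmod (fourier f (\<xi>, \<eta>))) \<le> ennreal C1 *
          (\<integral>\<^sup>+ z. ennreal (cmod (f z)) * (ennreal (decay (norm \<xi> *\<^sub>R fst z)) * ennreal (decay (norm \<eta> *\<^sub>R snd z))) \<partial>lborel)"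
          by (rule C1(2)[OF True sym])
        also have "\<dots> \<le> ennreal C1 * (ennreal (C2 * W) * X_norm p f)"
          unfolding W_def using nz by (intro mult_left_mono C2(2)) (auto simp: \<open>f \<in> borel_measurable borel\<close>)
        also have "\<dots> = ennreal (C1 * C2 * X * W)"
          using C1(1) C2(1) W real by (simp add: ennreal_mult[symmetric] mult_ac)
        finally show ?thesis
          using C1(1) C2(1) W real by (simp add: W_def)
      qed
    qed
    also have "\<dots> = ennreal (C3 * C1 * C2) * X_norm p f"
      using C1(1) C2(1) C3(1) real by (simp add: ennreal_mult[symmetric] mult_ac)
    finally show ?thesis .
  qed
  then show ?thesis unfolding q_def p_def by blast
qed

theorem theorem1p4:
  fixes d k m :: nat
  assumes "d \<ge> 4" and "k \<in> {2..d - 2}" and "m = min (d - k) k"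
    and "CARD('x::finite) = d - k" and "CARD('y::finite) = k"
  shows "\<exists>C::real. \<forall>f :: (real ^ 'x) \<times> (real ^ 'y) \<Rightarrow> complex.
           schwartz f \<longrightarrow> block_symmetric f \<longrightarrow>
           lorentz_norm_complex surface_measure (2 * real m / (real m - 1)) \<infinity> (fourier f)
             \<le> ennreal C * X_norm (2 * real m / (real m + 1)) f"
proof -
  have dims: "DIM(real ^ 'x) = d - k" "DIM(real ^ 'y) = k" using assms by simp_all
  then have "DIM(real ^ 'x) \<ge> 2" "DIM(real ^ 'y) \<ge> 2" "real m = real (min DIM(real ^ 'x) DIM(real ^ 'y))"
    using assms by auto
  from block_symmetric_restriction[OF this] show ?thesis by blast
qed

end
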